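(* (i) Let $L$ be an upper semimodular lattice of finite length. If $\operatorname{br}(L)\le 2$, then $L$ satisfies the $c_1$-median property. (ii) For each integer $k\ge 3$ there exists a finite upper semimodular lattice of breadth $k$ that fails to satisfy the $c_1$-median property. (iii) Let $t$ be a positive integer and, for $i=1,\dots,t$, let $L_i$ be a lattice of finite length satisfying the $c_1$-median property. Then the direct product $L:=L_1\times\dots\times L_t$ is a lattice of finite length, and it satisfies the $c_1$-median property. If all the $L_i$ are of finite breadth, then $\operatorname{br}(L)=\operatorname{br}(L_1)+\dots+\operatorname{br}(L_t)$. Furthermore, if all the $L_i$ are upper semimodular, then so is $L$.
   Context: A lattice is upper semimodular (semimodular) if for all $x,y$, $x\wedge y\prec x$ implies $y\prec x\vee y$, where $\prec$ is the covering relation. For a lattice $L$ of finite length, $d(x,y)$ denotes the length of a shortest path between $x$ and $y$ in the covering graph of $L$, i.e. the undirected graph on $L$ whose edges are the pairs $\{a,b\}$ with $a\prec b$. For a profile $\xi=(x_1,\dots,x_k)\in L^k$, an element $y\in L$ is a median of $\xi$ if $r(y,\xi):=\sum_{i=1}^k d(y,x_i)$ is minimum over $L$. $M(\xi)$ is the set of medians of $\xi$, and $c_1(\xi):=x_1\vee\dots\vee x_k$. The lattice $L$ satisfies the $c_1$-median property if, for every $k\ge 1$, every $\xi\in L^k$ and every $y\in M(\xi)$, we have $y\le c_1(\xi)$. The breadth $\operatorname{br}(L)$ of a lattice $L$ is the least positive integer $n$ such that every join $\bigvee_{i=1}^m x_i$ with $x_i\in L$ and $m\ge n$ equals the join of some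 $n$ of the joinands $x_i$. By convention, the singleton lattice has breadth $0$. *)

theory Defs
  imports "HOL-Library.FuncSet"
begin

text \<open>A lattice is given explicitly by a carrier set A and an order relation le
  (only its restriction to A matters).\<close>

definition is_lub :: "'a set \<Rightarrow> ('a \<Rightarrow> 'a \<Rightarrow> bool) \<Rightarrow> 'a set \<Rightarrow> 'a \<Rightarrow> bool" where
  "is_lub A le S z \<longleftrightarrow> z \<in> A \<and> (\<forall>s\<in>S. le s z) \<and> (\<forall>w\<in>A. (\<forall>s\<in>S. le s w) \<longrightarrow> le z w)"

definition is_glb :: "'a set \<Rightarrow> ('a \<Rightarrow> 'a \<Rightarrow> bool) \<Rightarrow> 'a set \<Rightarrow> 'a \<Rightarrow> bool" where
  "is_glb A le S z \<longleftrightarrow> z \<in> A \<and> (\<forall>s\<in>S. le z s) \<and> (\<forall>w\<in>A. (\<forall>s\<in>S. le w s) \<longrightarrow> le w z)"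

definition lattice_on :: "'a set \<Rightarrow> ('a \<Rightarrow> 'a \<Rightarrow> bool) \<Rightarrow> bool" where
  "lattice_on A le \<longleftrightarrow> A \<noteq> {}
     \<and> (\<forall>x\<in>A. le x x)
     \<and> (\<forall>x\<in>A. \<forall>y\<in>A. le x y \<and> le y x \<longrightarrow> x = y)
     \<and> (\<forall>x\<in>A. \<forall>y\<in>A. \<forall>z\<in>A. le x y \<and> le y z \<longrightarrow> le x z)
     \<and> (\<forall>x\<in>A. \<forall>y\<in>A. (\<exists>z. is_lub A le {x, y} z) \<and> (\<exists>z. is_glb A le {x, y} z))"

definition Join :: "'a set \<Rightarrow> ('a \<Rightarrow> 'a \<Rightarrow> bool) \<Rightarrow> 'a set \<Rightarrow> 'a" where
  "Join A le S = (THE z. is_lub A le S z)"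

definition join :: "'a set \<Rightarrow> ('a \<Rightarrow> 'a \<Rightarrow> bool) \<Rightarrow> 'a \<Rightarrow> 'a \<Rightarrow> 'a" where
  "join A le x y = Join A le {x, y}"

definition meet :: "'a set \<Rightarrow> ('a \<Rightarrow> 'a \<Rightarrow> bool) \<Rightarrow> 'a \<Rightarrow> 'a \<Rightarrow> 'a" where
  "meet A le x y = (THE z. is_glb A le {x, y} z)"

definition covers :: "'a set \<Rightarrow> ('a \<Rightarrow> 'a \<Rightarrow> bool) \<Rightarrow> 'a \<Rightarrow> 'a \<Rightarrow> bool" where
  "covers A le x y \<longleftrightarrow> x \<in> A \<and> y \<in> A \<and> le x y \<and> x \<noteq> y
     \<and> (\<forall>z\<in>A. le x z \<and> le z y \<longrightarrow> z = x \<or> z = y)"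

definition finite_length :: "'a set \<Rightarrow> ('a \<Rightarrow> 'a \<Rightarrow> bool) \<Rightarrow> bool" where
  "finite_length A le \<longleftrightarrow> (\<exists>n::nat. \<forall>C. C \<subseteq> A \<and> (\<forall>x\<in>C. \<forall>y\<in>C. le x y \<or> le y x)
        \<longrightarrow> finite C \<and> card C \<le> n)"

definition upper_semimodular :: "'a set \<Rightarrow> ('a \<Rightarrow> 'a \<Rightarrow> bool) \<Rightarrow> bool" where
  "upper_semimodular A le \<longleftrightarrow> (\<forall>x\<in>A. \<forall>y\<in>A.
      covers A le (meet A le x y) x \<longrightarrow> covers A le y (join A le x y))"

definition cover_path :: "'a set \<Rightarrow> ('a \<Rightarrow> 'a \<Rightarrow> bool) \<Rightarrow> 'a list \<Rightarrow> bool" where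
  "cover_path A le xs \<longleftrightarrow> xs \<noteq> [] \<and> set xs \<subseteq> A \<and>
     (\<forall>i. Suc i < length xs \<longrightarrow>
        covers A le (xs ! i) (xs ! Suc i) \<or> covers A le (xs ! Suc i) (xs ! i))"

definition cdist :: "'a set \<Rightarrow> ('a \<Rightarrow> 'a \<Rightarrow> bool) \<Rightarrow> 'a \<Rightarrow> 'a \<Rightarrow> nat" where
  "cdist A le x y = (LEAST n. \<exists>xs. cover_path A le xs \<and> hd xs = x \<and> last xs = y
                                  \<and> length xs = Suc n)"

definition remoteness :: "'a set \<Rightarrow> ('a \<Rightarrow> 'a \<Rightarrow> bool) \<Rightarrow> 'a \<Rightarrow> 'a list \<Rightarrow> nat" where
  "remoteness A le y xi = (\<Sum>i<length xi. cdist A le y (xi ! i))"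

definition is_median :: "'a set \<Rightarrow> ('a \<Rightarrow> 'a \<Rightarrow> bool) \<Rightarrow> 'a list \<Rightarrow> 'a \<Rightarrow> bool" where
  "is_median A le xi y \<longleftrightarrow> y \<in> A \<and> (\<forall>z\<in>A. remoteness A le y xi \<le> remoteness A le z xi)"

definition c1 :: "'a set \<Rightarrow> ('a \<Rightarrow> 'a \<Rightarrow> bool) \<Rightarrow> 'a list \<Rightarrow> 'a" where
  "c1 A le xi = Join A le (set xi)"

definition c1_median_property :: "'a set \<Rightarrow> ('a \<Rightarrow> 'a \<Rightarrow> bool) \<Rightarrow> bool" where
  "c1_median_property A le \<longleftrightarrow> (\<forall>xi. xi \<noteq> [] \<and> set xi \<subseteq> A \<longrightarrow>
      (\<forall>y. is_median A le xi y \<longrightarrow> le y (c1 A le xi)))"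

definition breadth_prop :: "'a set \<Rightarrow> ('a \<Rightarrow> 'a \<Rightarrow> bool) \<Rightarrow> nat \<Rightarrow> bool" where
  "breadth_prop A le n \<longleftrightarrow> (\<forall>m x. m \<ge> n \<and> (\<forall>i<m. x i \<in> A) \<longrightarrow>
      (\<exists>I \<subseteq> {..<m}. card I = n \<and> Join A le (x ` I) = Join A le (x ` {..<m})))"

definition has_breadth :: "'a set \<Rightarrow> ('a \<Rightarrow> 'a \<Rightarrow> bool) \<Rightarrow> nat \<Rightarrow> bool" where
  "has_breadth A le n \<longleftrightarrow>
     (if (\<exists>a. A = {a}) then n = 0
      else 0 < n \<and> breadth_prop A le n \<and> (\<forall>m. 0 < m \<and> m < n \<longrightarrow> \<not> breadth_prop A le m))"

definition prod_carrier :: "nat \<Rightarrow> (nat \<Rightarrow> 'a set) \<Rightarrow> (nat \<Rightarrow> 'a) set" where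
  "prod_carrier t A = PiE {..<t} A"

definition prod_le :: "nat \<Rightarrow> (nat \<Rightarrow> 'a \<Rightarrow> 'a \<Rightarrow> bool) \<Rightarrow> (nat \<Rightarrow> 'a) \<Rightarrow> (nat \<Rightarrow> 'a) \<Rightarrow> bool" where
  "prod_le t le f g \<longleftrightarrow> (\<forall>i<t. le i (f i) (g i))"

end

theory Submission
  imports Defs "HOL-Library.Product_Order"
begin

text \<open>
  In a semimodular lattice of finite length with rank function \<open>h\<close> the distance is
  \<open>d(x, y) = 2 h(x \<or> y) - h(x) - h(y)\<close>.

  For breadth at most 2, let \<open>y\<close> be a median with \<open>y \<not>\<le> c\<close>, where \<open>c\<close> is the join of the profile. As
  \<open>x\<^sub>i \<or> x\<^sub>j\<close> does not dominate \<open>y\<close>, the elements \<open>y \<or> x\<^sub>i\<close> form a chain. If fewer than half of the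
  \<open>x\<^sub>i\<close> were below \<open>y\<close>, a cover of \<open>y\<close> below the smallest \<open>y \<or> x\<^sub>i > y\<close> would be closer to the profile;
  hence at least half of them are below \<open>y\<close>, and then \<open>y \<and> c\<close> is strictly closer than \<open>y\<close>.

  For breadth 3 take the closed elements of the polymatroid rank function
  \<open>min(i + j + k, 9 + i, 9 + j, 12 + k, 13)\<close> on \<open>[0, 8] \<times> [0, 8] \<times> [0, 5]\<close>, with the profile
  \<open>(0, 0, 0), (8, 0, 0), (0, 8, 0)\<close>. The element \<open>(0, 0, 5)\<close> has remoteness 15, and every element below
  the join \<open>(8, 8, 0)\<close> of the profile has remoteness at least 16. Products with two-element chains
  raise the breadth, because distances, and hence medians, in a direct product are computed
  componentwise.
\<close>

section \<open>The covering graph\<close>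

text \<open>Three obstacles shape the development. Breadth is defined by equations between joins
  over index sets of a prescribed size, which is awkward for products and for changes of carrier; it
  is replaced by a condition on upper bounds. The distance formula needs a rank function, and a
  semimodular lattice of finite length has one only by a Jordan-Dedekind argument; since
  semimodularity completes squares upwards, lengths of paths towards the top are compared, which
  yields a corank. Finally, the lattices of breadth \<open>k\<close> arise as sets of functions and
  have to be copied into the natural numbers.

  The counterexample exploits a shortcut outside the ideal below the join. Going from the origin to
  \<open>(0, 0, 5)\<close> costs five steps, but seen from \<open>(8, 0, 0)\<close> or
  \<open>(0, 8, 0)\<close> these five units raise the rank by one only. Each of the two distances
  therefore falls from 8 to 5, a gain of 6 against a cost of 5.\<close>

definition cover_edges :: "'a set \<Rightarrow> ('a \<Rightarrow> 'a \<Rightarrow> bool) \<Rightarrow> ('a \<times> 'a) set" where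
  "cover_edges A le = {(x, y). covers A le x y \<or> covers A le y x}"

lemma coversD:
  assumes "covers A le x y"
  shows "x \<in> A" "y \<in> A" "le x y" "x \<noteq> y" "z \<in> A \<Longrightarrow> le x z \<Longrightarrow> le z y \<Longrightarrow> z = x \<or> z = y"
  using assms by (auto simp: covers_def)

lemma cover_edges_in: "(x, y) \<in> cover_edges A le \<Longrightarrow> x \<in> A \<and> y \<in> A"
  by (auto simp: cover_edges_def covers_def)

lemma cover_edges_sym: "(x, y) \<in> cover_edges A le \<Longrightarrow> (y, x) \<in> cover_edges A le"
  by (auto simp: cover_edges_def)

lemma cover_edges_relpow_sym: "(x, y) \<in> cover_edges A le ^^ n \<Longrightarrow> (y, x) \<in> cover_edges A le ^^ n"
proof (induction n arbitrary: y)
  case (Suc n)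
  then obtain z where "(x, z) \<in> cover_edges A le ^^ n" "(z, y) \<in> cover_edges A le" by auto
  then show ?case using Suc.IH by (meson cover_edges_sym relpow_Suc_I2)
qed auto

lemma cover_edges_relpow_meet:
  assumes "(x, z) \<in> cover_edges A le ^^ m" "(y, z) \<in> cover_edges A le ^^ n"
  shows "(x, y) \<in> cover_edges A le ^^ (m + n)"
  unfolding relpow_add using assms(1) cover_edges_relpow_sym[OF assms(2)] by (rule relcompI)

text \<open>Relational powers can be concatenated, reversed and extended at either end without list
  bookkeeping. The hypothesis \<open>x \<in> A\<close> matters for \<open>n = 0\<close>, where the
  power is the identity on the whole type but a path must stay in \<open>A\<close>.\<close>

lemma cover_path_iff_relpow:
  assumes "x \<in> A"
  shows "(\<exists>xs. cover_path A le xs \<and> hd xs = x \<and> last xs = y \<and> length xs = Suc n)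
    \<longleftrightarrow> (x, y) \<in> cover_edges A le ^^ n"
proof
  assume "\<exists>xs. cover_path A le xs \<and> hd xs = x \<and> last xs = y \<and> length xs = Suc n"
  then obtain xs where xs: "cover_path A le xs" "hd xs = x" "last xs = y" "length xs = Suc n" by blast
  have "xs ! 0 = x" "xs ! n = y"
    using xs by (metis hd_conv_nth list.size(3) nat.distinct(1),
        metis last_conv_nth diff_Suc_1 list.size(3) nat.distinct(1))
  moreover have "\<forall>i<n. (xs ! i, xs ! Suc i) \<in> cover_edges A le"
    using xs by (auto simp: cover_path_def cover_edges_def)
  ultimately show "(x, y) \<in> cover_edges A le ^^ n" unfolding relpow_fun_conv by blast
next
  assume "(x, y) \<in> cover_edges A le ^^ n"
  then obtain f where f: "f 0 = x" "f n = y" "\<forall>i<n. (f i, f (Suc i)) \<in> cover_edges A le"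
    unfolding relpow_fun_conv by blast
  let ?xs = "map f [0..<Suc n]"
  have "f i \<in> A" if "i \<le> n" for i
    using that f assms by (cases i) (auto simp: Suc_le_eq dest: cover_edges_in)
  then have "cover_path A le ?xs"
    using f(3) by (auto simp: cover_path_def cover_edges_def simp del: upt_Suc)
  moreover have "hd ?xs = x" "last ?xs = y" using f by (simp_all add: hd_map del: upt_Suc) (simp add: last_map)
  ultimately show "\<exists>xs. cover_path A le xs \<and> hd xs = x \<and> last xs = y \<and> length xs = Suc n"
    by (intro exI[of _ ?xs]) auto
qed

lemma cdist_eq_Least: "x \<in> A \<Longrightarrow> cdist A le x y = (LEAST n. (x, y) \<in> cover_edges A le ^^ n)"
  unfolding cdist_def by (simp add: cover_path_iff_relpow)

lemma cdist_le: "x \<in> A \<Longrightarrow> (x, y) \<in> cover_edges A le ^^ n \<Longrightarrow> cdist A le x y \<le> n"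
  by (simp add: cdist_eq_Least Least_le)

section \<open>Joins, meets and breadth\<close>

locale lattice_carrier =
  fixes A :: "'a set" and le :: "'a \<Rightarrow> 'a \<Rightarrow> bool"
  assumes lattice: "lattice_on A le"
begin

abbreviation jn where "jn \<equiv> join A le"
abbreviation mt where "mt \<equiv> meet A le"

lemma nonempty: "A \<noteq> {}"
  and refl: "x \<in> A \<Longrightarrow> le x x"
  and antisym: "x \<in> A \<Longrightarrow> y \<in> A \<Longrightarrow> le x y \<Longrightarrow> le y x \<Longrightarrow> x = y"
  and trans: "le x y \<Longrightarrow> le y z \<Longrightarrow> x \<in> A \<Longrightarrow> y \<in> A \<Longrightarrow> z \<in> A \<Longrightarrow> le x z"
  and ex_lub: "x \<in> A \<Longrightarrow> y \<in> A \<Longrightarrow> \<exists>z. is_lub A le {x, y} z"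
  and ex_glb: "x \<in> A \<Longrightarrow> y \<in> A \<Longrightarrow> \<exists>z. is_glb A le {x, y} z"
  using lattice unfolding lattice_on_def by blast+

lemma Join_eqI: "is_lub A le S z \<Longrightarrow> Join A le S = z"
  unfolding Join_def by (rule the_equality) (auto simp: is_lub_def intro: antisym)

lemma join_eqI: "is_lub A le {x, y} z \<Longrightarrow> jn x y = z"
  unfolding join_def by (rule Join_eqI)

lemma meet_eqI: "is_glb A le {x, y} z \<Longrightarrow> mt x y = z"
  unfolding meet_def by (rule the_equality) (auto simp: is_glb_def intro: antisym)

lemma join_is_lub: "x \<in> A \<Longrightarrow> y \<in> A \<Longrightarrow> is_lub A le {x, y} (jn x y)"
  using ex_lub join_eqI by metis

lemma meet_is_glb: "x \<in> A \<Longrightarrow> y \<in> A \<Longrightarrow> is_glb A le {x, y} (mt x y)"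
  using ex_glb meet_eqI by metis

lemma join_in [simp]: "x \<in> A \<Longrightarrow> y \<in> A \<Longrightarrow> jn x y \<in> A"
  and join_upper1: "x \<in> A \<Longrightarrow> y \<in> A \<Longrightarrow> le x (jn x y)"
  and join_upper2: "x \<in> A \<Longrightarrow> y \<in> A \<Longrightarrow> le y (jn x y)"
  and join_least: "x \<in> A \<Longrightarrow> y \<in> A \<Longrightarrow> z \<in> A \<Longrightarrow> le x z \<Longrightarrow> le y z \<Longrightarrow> le (jn x y) z"
  using join_is_lub[of x y] by (auto simp: is_lub_def)

lemma meet_in [simp]: "x \<in> A \<Longrightarrow> y \<in> A \<Longrightarrow> mt x y \<in> A"
  and meet_lower1: "x \<in> A \<Longrightarrow> y \<in> A \<Longrightarrow> le (mt x y) x"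
  and meet_lower2: "x \<in> A \<Longrightarrow> y \<in> A \<Longrightarrow> le (mt x y) y"
  and meet_greatest: "x \<in> A \<Longrightarrow> y \<in> A \<Longrightarrow> z \<in> A \<Longrightarrow> le z x \<Longrightarrow> le z y \<Longrightarrow> le z (mt x y)"
  using meet_is_glb[of x y] by (auto simp: is_glb_def)

lemma join_absorb: "x \<in> A \<Longrightarrow> y \<in> A \<Longrightarrow> le x y \<Longrightarrow> jn x y = y"
  by (rule join_eqI) (auto simp: is_lub_def refl)

lemma join_commute: "jn x y = jn y x"
  by (simp add: join_def insert_commute)

lemma Join_is_lub:
  assumes "finite S" "S \<noteq> {}" "S \<subseteq> A"
  shows "is_lub A le S (Join A le S)"
proof -
  have "\<exists>z. is_lub A le S z" using assms
  proof (induction S rule: finite_ne_induct)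
    case (singleton x)
    then show ?case by (intro exI[of _ x]) (auto simp: is_lub_def refl)
  next
    case (insert x F)
    then obtain z where z: "is_lub A le F z" by auto
    then have zA: "z \<in> A" by (auto simp: is_lub_def)
    have "x \<in> A" "F \<subseteq> A" using insert by auto
    have "is_lub A le (insert x F) (jn x z)"
      unfolding is_lub_def
    proof (intro conjI ballI impI)
      fix s assume "s \<in> insert x F"
      then show "le s (jn x z)"
        using z zA \<open>x \<in> A\<close> \<open>F \<subseteq> A\<close> join_upper1[of x z] join_upper2[of x z]
        by (auto simp: is_lub_def intro: trans[of s z "jn x z"])
    next
      fix w assume "w \<in> A" "\<forall>s\<in>insert x F. le s w"
      then show "le (jn x z) w" using z zA \<open>x \<in> A\<close> by (auto simp: is_lub_def intro: join_least)
    qed (use zA \<open>x \<in> A\<close> in auto)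
    then show ?case ..
  qed
  then show ?thesis using Join_eqI by metis
qed

lemma Join_in: "finite S \<Longrightarrow> S \<noteq> {} \<Longrightarrow> S \<subseteq> A \<Longrightarrow> Join A le S \<in> A"
  and Join_upper: "finite S \<Longrightarrow> S \<noteq> {} \<Longrightarrow> S \<subseteq> A \<Longrightarrow> s \<in> S \<Longrightarrow> le s (Join A le S)"
  and Join_least: "finite S \<Longrightarrow> S \<noteq> {} \<Longrightarrow> S \<subseteq> A \<Longrightarrow> w \<in> A \<Longrightarrow> (\<And>s. s \<in> S \<Longrightarrow> le s w) \<Longrightarrow> le (Join A le S) w"
  using Join_is_lub[of S] by (auto simp: is_lub_def)

text \<open>Two joins agree iff every upper bound of the smaller family bounds the larger one;
  \<open>0 < n\<close> makes \<open>I\<close> nonempty, so that \<open>Join\<close> denotes a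
  genuine least upper bound. The right-hand side can be checked coordinate by coordinate and pulled
  back along order embeddings.\<close>

lemma breadth_prop_iff:
  assumes n: "0 < n"
  shows "breadth_prop A le n \<longleftrightarrow> (\<forall>m x. n \<le> m \<and> (\<forall>i<m. x i \<in> A) \<longrightarrow>
    (\<exists>I\<subseteq>{..<m}. card I = n \<and> (\<forall>w\<in>A. (\<forall>i\<in>I. le (x i) w) \<longrightarrow> (\<forall>i<m. le (x i) w))))"
proof -
  have *: "Join A le (x ` I) = Join A le (x ` {..<m}) \<longleftrightarrow>
      (\<forall>w\<in>A. (\<forall>i\<in>I. le (x i) w) \<longrightarrow> (\<forall>i<m. le (x i) w))"
    if m: "n \<le> m" "\<forall>i<m. x i \<in> A" and I: "I \<subseteq> {..<m}" "card I = n" for m x I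
  proof -
    have "I \<noteq> {}" using I n by auto
    have fin: "finite I" using I finite_subset by blast
    have 1: "is_lub A le (x ` I) (Join A le (x ` I))"
      using m I fin \<open>I \<noteq> {}\<close> by (intro Join_is_lub) auto
    have 2: "is_lub A le (x ` {..<m}) (Join A le (x ` {..<m}))"
      using m n by (intro Join_is_lub) (auto simp: lessThan_empty_iff)
    show ?thesis
    proof
      assume eq: "Join A le (x ` I) = Join A le (x ` {..<m})"
      show "\<forall>w\<in>A. (\<forall>i\<in>I. le (x i) w) \<longrightarrow> (\<forall>i<m. le (x i) w)"
      proof (intro ballI impI allI)
        fix w i assume w: "w \<in> A" "\<forall>i\<in>I. le (x i) w" and "i < m"
        have "le (Join A le (x ` I)) w" using 1 w by (auto simp: is_lub_def)
        moreover have "le (x i) (Join A le (x ` I))" using 2 eq \<open>i < m\<close> by (auto simp: is_lub_def)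
        ultimately show "le (x i) w"
          using 1 w m \<open>i < m\<close> by (auto simp: is_lub_def intro: trans)
      qed
    next
      assume "\<forall>w\<in>A. (\<forall>i\<in>I. le (x i) w) \<longrightarrow> (\<forall>i<m. le (x i) w)"
      then have "is_lub A le (x ` {..<m}) (Join A le (x ` I))"
        using 1 I(1) by (auto simp: is_lub_def) blast
      then show "Join A le (x ` I) = Join A le (x ` {..<m})" using Join_eqI by metis
    qed
  qed
  have "(\<exists>I\<subseteq>{..<m}. card I = n \<and> Join A le (x ` I) = Join A le (x ` {..<m})) \<longleftrightarrow>
      (\<exists>I\<subseteq>{..<m}. card I = n \<and> (\<forall>w\<in>A. (\<forall>i\<in>I. le (x i) w) \<longrightarrow> (\<forall>i<m. le (x i) w)))"
    if "n \<le> m \<and> (\<forall>i<m. x i \<in> A)" for m x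
    by (intro ex_cong1 conj_cong) (use that *[of m x] in auto)
  note eq = this
  show ?thesis unfolding breadth_prop_def
  proof (rule iffI; rule allI; rule allI; rule impI)
    fix m x assume a: "n \<le> m \<and> (\<forall>i<m. x i \<in> A)"
    {
      assume "\<forall>m x. n \<le> m \<and> (\<forall>i<m. x i \<in> A) \<longrightarrow>
        (\<exists>I\<subseteq>{..<m}. card I = n \<and> Join A le (x ` I) = Join A le (x ` {..<m}))"
      from this[rule_format, OF a]
      show "\<exists>I\<subseteq>{..<m}. card I = n \<and> (\<forall>w\<in>A. (\<forall>i\<in>I. le (x i) w) \<longrightarrow> (\<forall>i<m. le (x i) w))"
        unfolding eq[OF a] .
    next
      assume "\<forall>m x. n \<le> m \<and> (\<forall>i<m. x i \<in> A) \<longrightarrow>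
        (\<exists>I\<subseteq>{..<m}. card I = n \<and> (\<forall>w\<in>A. (\<forall>i\<in>I. le (x i) w) \<longrightarrow> (\<forall>i<m. le (x i) w)))"
      from this[rule_format, OF a]
      show "\<exists>I\<subseteq>{..<m}. card I = n \<and> Join A le (x ` I) = Join A le (x ` {..<m})"
        unfolding eq[OF a] .
    }
  qed
qed

lemma breadth_propE:
  assumes "breadth_prop A le n" "0 < n" "n \<le> m" "\<And>i. i < m \<Longrightarrow> x i \<in> A"
  obtains I where "I \<subseteq> {..<m}" "card I = n"
    "\<And>w i. w \<in> A \<Longrightarrow> (\<And>i. i \<in> I \<Longrightarrow> le (x i) w) \<Longrightarrow> i < m \<Longrightarrow> le (x i) w"
  using breadth_prop_iff[THEN iffD1, rule_format, of n m x] assms by auto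

text \<open>Too few indices do no harm: adding arbitrary further ones keeps the condition on upper
  bounds, and \<open>n \<le> m\<close> leaves room for exactly \<open>n\<close>.\<close>

lemma breadth_propI:
  assumes "0 < n"
    and "\<And>m x. n \<le> m \<Longrightarrow> (\<And>i. i < m \<Longrightarrow> x i \<in> A) \<Longrightarrow>
      \<exists>I\<subseteq>{..<m}. card I \<le> n \<and> (\<forall>w\<in>A. (\<forall>i\<in>I. le (x i) w) \<longrightarrow> (\<forall>i<m. le (x i) w))"
  shows "breadth_prop A le n"
  unfolding breadth_prop_iff[OF assms(1)]
proof (intro allI impI)
  fix m :: nat and x assume mx: "n \<le> m \<and> (\<forall>i<m. x i \<in> A)"
  then obtain I where I: "I \<subseteq> {..<m}" "card I \<le> n"
    "\<forall>w\<in>A. (\<forall>i\<in>I. le (x i) w) \<longrightarrow> (\<forall>i<m. le (x i) w)" using assms(2)[of m x] by blast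
  have "\<exists>J. I \<subseteq> J \<and> J \<subseteq> {..<m} \<and> card J = n"
    using exists_subset_between[of I n "{..<m}"] I mx by simp
  then obtain J where "I \<subseteq> J" "J \<subseteq> {..<m}" "card J = n" by blast
  then show "\<exists>I\<subseteq>{..<m}. card I = n \<and> (\<forall>w\<in>A. (\<forall>i\<in>I. le (x i) w) \<longrightarrow> (\<forall>i<m. le (x i) w))"
    using I(3) by (intro exI[of _ J]) blast
qed

text \<open>Any \<open>n\<close> of the \<open>m\<close> indices miss some \<open>j\<close>, and the
  element \<open>w\<close> bounding all members but the \<open>j\<close>-th shows that they do not
  suffice.\<close>

lemma not_breadth_propI:
  assumes "n < m" "0 < n" "\<And>i. i < m \<Longrightarrow> x i \<in> A"
    and "\<And>j. j < m \<Longrightarrow> \<exists>w\<in>A. (\<forall>i<m. i \<noteq> j \<longrightarrow> le (x i) w) \<and> \<not> le (x j) w"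
  shows "\<not> breadth_prop A le n"
proof
  assume "breadth_prop A le n"
  then obtain I where I: "I \<subseteq> {..<m}" "card I = n"
    "\<And>w i. w \<in> A \<Longrightarrow> (\<And>i. i \<in> I \<Longrightarrow> le (x i) w) \<Longrightarrow> i < m \<Longrightarrow> le (x i) w"
    using assms(1,2,3) by (auto elim!: breadth_propE[where m = m and x = x])
  have "I \<noteq> {..<m}" using I(2) assms(1) by auto
  then obtain j where "j < m" "j \<notin> I" using I(1) by auto
  moreover obtain w where "w \<in> A" "\<forall>i<m. i \<noteq> j \<longrightarrow> le (x i) w" "\<not> le (x j) w"
    using assms(4)[OF \<open>j < m\<close>] by blast
  ultimately show False using I(1) I(3)[of w j] by (auto simp: subset_iff)
qed

text \<open>Minimality of \<open>b\<close> provides a family for which no \<open>b - 1\<close>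
  members suffice, while some \<open>b\<close> of them do. Those \<open>b\<close> are irredundant,
  since dropping a redundant one would leave \<open>b - 1\<close> sufficient members.\<close>

lemma irredundant_family:
  assumes b: "has_breadth A le b"
  obtains x where "\<And>i. i < b \<Longrightarrow> x i \<in> A"
    "\<And>j. j < b \<Longrightarrow> \<exists>w\<in>A. (\<forall>i<b. i \<noteq> j \<longrightarrow> le (x i) w) \<and> \<not> le (x j) w"
proof -
  consider "b = 0" | "b = 1" | "b \<ge> 2" by linarith
  then show thesis
  proof cases
    case 1
    then show thesis using that by auto
  next
    \<comment> \<open>Only positive numbers compete in \<open>has_breadth\<close>, so breadth 1
      refutes nothing smaller; instead a carrier with two elements supplies an \<open>a\<close> not
      below some \<open>w\<close>.\<close>
    case 2
    then have "\<not> (\<exists>a. A = {a})" using b by (auto simp: has_breadth_def split: if_splits)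
    then obtain u v where uv: "u \<in> A" "v \<in> A" "u \<noteq> v" using nonempty by blast
    then have "\<not> le u v \<or> \<not> le v u" using antisym by blast
    then obtain a w where "a \<in> A" "w \<in> A" "\<not> le a w" using uv by blast
    then show thesis using that[of "\<lambda>_. a"] 2 by auto
  next
    case 3
    then have bp: "breadth_prop A le b" "\<not> breadth_prop A le (b - 1)"
      using b by (auto simp: has_breadth_def split: if_splits)
    have pos: "0 < b - 1" "0 < b" using 3 by auto
    define Q where "Q m x I \<longleftrightarrow> (\<forall>w\<in>A. (\<forall>i\<in>I. le (x i) w) \<longrightarrow> (\<forall>i<m. le (x i) w))"
      for m :: nat and x :: "nat \<Rightarrow> 'a" and I
    have "\<not> (\<forall>m x. b - 1 \<le> m \<and> (\<forall>i<m. x i \<in> A) \<longrightarrow> (\<exists>I\<subseteq>{..<m}. card I = b - 1 \<and> Q m x I))"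
      using bp(2) unfolding breadth_prop_iff[OF pos(1)] Q_def .
    then obtain m x where m: "b - 1 \<le> m" "\<forall>i<m. x i \<in> A"
      and no': "\<not> (\<exists>I\<subseteq>{..<m}. card I = b - 1 \<and> Q m x I)" by metis
    have no: "\<exists>w\<in>A. (\<forall>i\<in>I. le (x i) w) \<and> \<not> (\<forall>i<m. le (x i) w)"
      if "I \<subseteq> {..<m}" "card I = b - 1" for I
      using no' that unfolding Q_def by auto
    \<comment> \<open>Otherwise the whole family would be a sufficient set of \<open>b - 1\<close>
      members.\<close>
    have "m \<noteq> b - 1" using no[of "{..<m}"] by auto
    then have "b \<le> m" using m by linarith
    then obtain I where I: "I \<subseteq> {..<m}" "card I = b"
      "\<And>w i. w \<in> A \<Longrightarrow> (\<And>i. i \<in> I \<Longrightarrow> le (x i) w) \<Longrightarrow> i < m \<Longrightarrow> le (x i) w"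
      using breadth_propE[OF bp(1) pos(2), of m x] m(2) by blast
    have finI: "finite I" using I finite_subset by blast
    then obtain h where h: "bij_betw h {..<b} I"
      using I(2) by (metis bij_betw_iff_card card_lessThan finite_lessThan)
    show thesis
    proof (rule that[of "x \<circ> h"])
      fix i assume "i < b"
      then have "h i \<in> I" using h by (auto simp: bij_betw_def)
      then show "(x \<circ> h) i \<in> A" using I(1) m(2) by auto
    next
      fix j assume j: "j < b"
      then have hj: "h j \<in> I" using h by (auto simp: bij_betw_def)
      have "I - {h j} \<subseteq> {..<m}" "card (I - {h j}) = b - 1" using I(1,2) finI hj by auto
      from no[OF this]
      obtain w where w: "w \<in> A" "\<forall>i\<in>I - {h j}. le (x i) w" "\<not> (\<forall>i<m. le (x i) w)"
        by blast
      have "\<not> le (x (h j)) w"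
      proof
        assume "le (x (h j)) w"
        then have "le (x i) w" if "i \<in> I" for i using w(2) that by (cases "i = h j") auto
        then show False using I(3)[OF w(1)] w(3) by simp
      qed
      moreover have "le (x (h i)) w" if "i < b" "i \<noteq> j" for i
        using w that h j by (auto simp: bij_betw_def inj_on_def)
      ultimately show "\<exists>w\<in>A. (\<forall>i<b. i \<noteq> j \<longrightarrow> le ((x \<circ> h) i) w) \<and> \<not> le ((x \<circ> h) j) w"
        using w(1) by auto
    qed
  qed
qed

end

section \<open>Distances in semimodular lattices of finite length\<close>

text \<open>A function that increases strictly along \<open>le\<close> is injective on chains, so a
  chain has at most \<open>N + 1\<close> elements.\<close>

lemma finite_lengthI:
  fixes h :: "'a \<Rightarrow> nat"
  assumes "\<And>x. x \<in> A \<Longrightarrow> h x \<le> N"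
    and "\<And>x y. x \<in> A \<Longrightarrow> y \<in> A \<Longrightarrow> le x y \<Longrightarrow> x \<noteq> y \<Longrightarrow> h x < h y"
  shows "finite_length A le"
  unfolding finite_length_def
proof (intro exI[of _ "Suc N"] allI impI)
  fix C assume C: "C \<subseteq> A \<and> (\<forall>x\<in>C. \<forall>y\<in>C. le x y \<or> le y x)"
  have inj: "inj_on h C"
  proof (rule inj_onI)
    fix x y assume xy: "x \<in> C" "y \<in> C" "h x = h y"
    show "x = y"
    proof (rule ccontr)
      assume "x \<noteq> y"
      then have "h x < h y \<or> h y < h x" using C xy assms(2)[of x y] assms(2)[of y x] by blast
      then show False using xy by simp
    qed
  qed
  have sub: "h ` C \<subseteq> {..N}" using C assms(1) by auto
  have "finite C" using finite_imageD[OF finite_subset[OF sub] inj] by simp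
  moreover have "card C \<le> card {..N}" using card_inj_on_le[OF inj sub] by simp
  ultimately show "finite C \<and> card C \<le> Suc N" by simp
qed

text \<open>\<open>h x\<close> is the largest size of a chain below \<open>x\<close>; such a chain
  can be extended by any \<open>y\<close> strictly above \<open>x\<close>. It serves as induction
  measure where no rank is available, and puts finite length into a form that adds up over
  products.\<close>

lemma strict_mono_rank_on_finite_length:
  assumes "lattice_on A le" "finite_length A le"
  obtains h :: "'a \<Rightarrow> nat" and N where "\<And>x. x \<in> A \<Longrightarrow> h x \<le> N"
    "\<And>x y. x \<in> A \<Longrightarrow> y \<in> A \<Longrightarrow> le x y \<Longrightarrow> x \<noteq> y \<Longrightarrow> h x < h y"
proof -
  interpret lattice_carrier A le using assms(1) by unfold_locales
  from assms(2)[unfolded finite_length_def]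
  obtain N where N': "\<forall>C. C \<subseteq> A \<and> (\<forall>x\<in>C. \<forall>y\<in>C. le x y \<or> le y x) \<longrightarrow> finite C \<and> card C \<le> N"
    by (rule exE)
  have N: "finite C \<and> card C \<le> N" if "C \<subseteq> A" "\<forall>x\<in>C. \<forall>y\<in>C. le x y \<or> le y x" for C
    using N' that by simp
  define Cs where "Cs x = {C. C \<subseteq> A \<and> (\<forall>u\<in>C. \<forall>v\<in>C. le u v \<or> le v u) \<and> (\<forall>u\<in>C. le u x)}" for x
  define h where "h x = Max (card ` Cs x)" for x
  have sub: "card ` Cs x \<subseteq> {..N}" for x using N unfolding Cs_def by auto
  then have fin: "finite (card ` Cs x)" for x using finite_subset by blast
  have ne: "card ` Cs x \<noteq> {}" for x unfolding Cs_def by blast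
  show thesis
  proof (rule that)
    show "h x \<le> N" for x using Max_in[OF fin[of x] ne] sub[of x] unfolding h_def by blast
  next
    fix x y assume xy: "x \<in> A" "y \<in> A" "le x y" "x \<noteq> y"
    obtain C where C: "C \<in> Cs x" "h x = card C" using Max_in[OF fin[of x] ne] unfolding h_def by blast
    have "y \<notin> C" using C xy antisym unfolding Cs_def by auto
    have "finite C" using C N unfolding Cs_def by blast
    have "insert y C \<in> Cs y"
      using C xy refl unfolding Cs_def by (auto intro: trans)
    then have "card (insert y C) \<le> h y" unfolding h_def using fin by (intro Max_ge) auto
    then show "h x < h y" using C \<open>y \<notin> C\<close> \<open>finite C\<close> by simp
  qed
qed

section \<open>Finite length without semimodularity\<close>

locale finite_length_lattice = lattice_carrier +
  assumes finite_length: "finite_length A le"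
begin

lemma ex_cover_below:
  assumes "x \<in> A" "y \<in> A" "le x y" "x \<noteq> y"
  obtains z where "covers A le x z" "le z y"
proof -
  obtain h :: "'a \<Rightarrow> nat" and N where h: "\<And>x y. x \<in> A \<Longrightarrow> y \<in> A \<Longrightarrow> le x y \<Longrightarrow> x \<noteq> y \<Longrightarrow> h x < h y"
    using strict_mono_rank_on_finite_length[OF lattice finite_length] by metis
  define P where "P z \<longleftrightarrow> z \<in> A \<and> le x z \<and> le z y \<and> x \<noteq> z" for z
  have "P y" using assms refl by (auto simp: P_def)
  then obtain z where z: "P z" "\<And>w. P w \<Longrightarrow> h z \<le> h w"
    using ex_has_least_nat[of P y h] by blast
  have "covers A le x z"
    unfolding covers_def
  proof (intro conjI ballI impI)
    fix w assume w: "w \<in> A" "le x w \<and> le w z"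
    show "w = x \<or> w = z"
    proof (rule ccontr)
      assume "\<not> (w = x \<or> w = z)"
      then have "P w" "h w < h z" using w z(1) assms h[of w z] by (auto simp: P_def intro: trans)
      then show False using z(2)[of w] by simp
    qed
  qed (use z(1) assms in \<open>auto simp: P_def\<close>)
  then show thesis using that z(1) by (auto simp: P_def)
qed

lemma ex_top: obtains u where "u \<in> A" "\<And>x. x \<in> A \<Longrightarrow> le x u"
proof -
  obtain h :: "'a \<Rightarrow> nat" and N where N: "\<And>x. x \<in> A \<Longrightarrow> h x \<le> N"
    and h: "\<And>x y. x \<in> A \<Longrightarrow> y \<in> A \<Longrightarrow> le x y \<Longrightarrow> x \<noteq> y \<Longrightarrow> h x < h y"
    using strict_mono_rank_on_finite_length[OF lattice finite_length] by metis
  obtain a where "a \<in> A" using nonempty by blast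
  then obtain u where u: "u \<in> A" "\<And>w. w \<in> A \<Longrightarrow> h w \<le> h u"
    using ex_has_greatest_nat[of "\<lambda>x. x \<in> A" a h "Suc N"] N by (auto simp: less_Suc_eq_le)
  show thesis
  proof (rule that[OF u(1)])
    fix x assume x: "x \<in> A"
    have "u = jn x u"
    proof (rule ccontr)
      assume "u \<noteq> jn x u"
      then show False using h[of u "jn x u"] u(2)[of "jn x u"] u(1) x join_upper2[of x u] by simp
    qed
    then show "le x u" using join_upper1[OF x u(1)] by simp
  qed
qed

lemma ex_bot: obtains u where "u \<in> A" "\<And>x. x \<in> A \<Longrightarrow> le u x"
proof -
  obtain h :: "'a \<Rightarrow> nat" and N where
    h: "\<And>x y. x \<in> A \<Longrightarrow> y \<in> A \<Longrightarrow> le x y \<Longrightarrow> x \<noteq> y \<Longrightarrow> h x < h y"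
    using strict_mono_rank_on_finite_length[OF lattice finite_length] by metis
  obtain a where "a \<in> A" using nonempty by blast
  then obtain u where u: "u \<in> A" "\<And>w. w \<in> A \<Longrightarrow> h u \<le> h w"
    using ex_has_least_nat[of "\<lambda>x. x \<in> A" a h] by blast
  show thesis
  proof (rule that[OF u(1)])
    fix x assume x: "x \<in> A"
    have "u = mt x u"
    proof (rule ccontr)
      assume "u \<noteq> mt x u"
      then show False using h[of "mt x u" u] u(2)[of "mt x u"] u(1) x meet_lower2[of x u] by auto
    qed
    then show "le u x" using meet_lower1[OF x u(1)] by simp
  qed
qed

lemma relpow_cover_above:
  assumes "x \<in> A" "y \<in> A" "le x y"
  shows "\<exists>n. (x, y) \<in> cover_edges A le ^^ n"
proof -
  obtain h :: "'a \<Rightarrow> nat" and N where N: "\<And>x. x \<in> A \<Longrightarrow> h x \<le> N"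
    and h: "\<And>x y. x \<in> A \<Longrightarrow> y \<in> A \<Longrightarrow> le x y \<Longrightarrow> x \<noteq> y \<Longrightarrow> h x < h y"
    using strict_mono_rank_on_finite_length[OF lattice finite_length] by metis
  from assms show ?thesis
  proof (induction "N - h x" arbitrary: x rule: less_induct)
    case less
    show ?case
    proof (cases "x = y")
      case True
      then show ?thesis by (auto intro: exI[of _ 0])
    next
      case False
      then obtain z where z: "covers A le x z" "le z y" using ex_cover_below less.prems by blast
      then have zA: "z \<in> A" by (auto simp: covers_def)
      have "h x < h z" using z less.prems h by (auto simp: covers_def)
      then have "N - h z < N - h x" using N[OF zA] by linarith
      then obtain n where "(z, y) \<in> cover_edges A le ^^ n" using less.hyps zA z less.prems by blast
      moreover have "(x, z) \<in> cover_edges A le" using z by (auto simp: cover_edges_def)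
      ultimately show ?thesis by (meson relpow_Suc_I2)
    qed
  qed
qed

text \<open>Both elements are connected to their join, so the covering graph is connected and the
  \<open>LEAST\<close> in \<open>cdist\<close> is attained.\<close>

lemma relpow_cdist:
  assumes "x \<in> A" "y \<in> A"
  shows "(x, y) \<in> cover_edges A le ^^ cdist A le x y"
proof -
  obtain m n where "(x, jn x y) \<in> cover_edges A le ^^ m" "(y, jn x y) \<in> cover_edges A le ^^ n"
    using relpow_cover_above join_upper1 join_upper2 join_in assms by meson
  then have "(x, y) \<in> cover_edges A le ^^ (m + n)"
    by (rule cover_edges_relpow_meet)
  then show ?thesis unfolding cdist_eq_Least[OF assms(1)] by (rule LeastI)
qed

lemma cdist_self [simp]: "x \<in> A \<Longrightarrow> cdist A le x x = 0"
  using cdist_le[where n = 0 and y = x] by simp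

lemma cdist_edge:
  assumes "(x, z) \<in> cover_edges A le" "y \<in> A"
  shows "cdist A le x y \<le> Suc (cdist A le z y)"
proof -
  have A: "x \<in> A" "z \<in> A" using cover_edges_in[OF assms(1)] by auto
  show ?thesis by (rule cdist_le[OF A(1) relpow_Suc_I2[OF assms(1) relpow_cdist[OF A(2) assms(2)]]])
qed

end

text \<open>The rank is integer valued because it is instantiated both by a negated corank and by
  the rank function of a polymatroid.\<close>

locale graded_semimodular_lattice = finite_length_lattice +
  fixes rk :: "'a \<Rightarrow> int"
  assumes semimodular: "upper_semimodular A le"
    and rk_cover: "covers A le x y \<Longrightarrow> rk y = rk x + 1"
begin

lemma rk_strict_mono:
  assumes "x \<in> A" "y \<in> A" "le x y" "x \<noteq> y"
  shows "rk x < rk y"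
proof -
  obtain h :: "'a \<Rightarrow> nat" and N where N: "\<And>x. x \<in> A \<Longrightarrow> h x \<le> N"
    and h: "\<And>x y. x \<in> A \<Longrightarrow> y \<in> A \<Longrightarrow> le x y \<Longrightarrow> x \<noteq> y \<Longrightarrow> h x < h y"
    using strict_mono_rank_on_finite_length[OF lattice finite_length] by metis
  from assms show ?thesis
  proof (induction "N - h x" arbitrary: x rule: less_induct)
    case less
    obtain z where z: "covers A le x z" "le z y" by (rule ex_cover_below[OF less.prems])
    then have zA: "z \<in> A" by (auto simp: covers_def)
    have "h x < h z" using z less.prems h by (auto simp: covers_def)
    then have "N - h z < N - h x" using N[OF zA] by linarith
    then have "z = y \<or> rk z < rk y" using less.hyps[OF _ zA less.prems(2) z(2)] by blast
    then show ?case using rk_cover[OF z(1)] by auto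
  qed
qed

lemma rk_mono: "x \<in> A \<Longrightarrow> y \<in> A \<Longrightarrow> le x y \<Longrightarrow> rk x \<le> rk y"
  using rk_strict_mono by (cases "x = y") (auto intro: less_imp_le)

text \<open>Either \<open>z\<close> is already below \<open>jn x y\<close>, or \<open>z\<close>
  meets that join in \<open>y\<close>, because \<open>z\<close> covers \<open>y\<close>;
  semimodularity applied to \<open>z\<close> and \<open>jn x y\<close> then gives the cover.\<close>

lemma join_cover:
  assumes "covers A le y z" "x \<in> A"
  shows "jn x z = jn x y \<or> covers A le (jn x y) (jn x z)"
proof -
  have yz: "y \<in> A" "z \<in> A" "le y z" using assms(1) by (auto simp: covers_def)
  let ?u = "jn x y"
  have u: "?u \<in> A" "le x ?u" "le y ?u" using assms(2) yz join_upper1 join_upper2 by auto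
  show ?thesis
  proof (cases "le z ?u")
    case True
    have "jn x z = ?u"
    proof (rule antisym)
      show "le (jn x z) ?u" using True u assms(2) yz by (intro join_least) auto
      show "le ?u (jn x z)"
        using assms(2) yz join_upper1[of x z] join_upper2[of x z]
        by (intro join_least) (auto intro: trans[of y z])
    qed (use assms(2) yz in auto)
    then show ?thesis ..
  next
    case False
    have "le y (mt z ?u)" using u yz by (intro meet_greatest) auto
    moreover have "le (mt z ?u) z" "le (mt z ?u) ?u" using u yz meet_lower1 meet_lower2 by auto
    ultimately have "mt z ?u = y"
      using coversD(5)[OF assms(1), of "mt z ?u"] u yz False by auto
    then have "covers A le ?u (jn z ?u)"
      using semimodular yz u assms(1) unfolding upper_semimodular_def by auto
    moreover have "jn z ?u = jn x z"
    proof (rule antisym)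
      show "le (jn z ?u) (jn x z)"
        using assms(2) yz u join_upper1[of x z] join_upper2[of x z]
        by (intro join_least) (auto intro: trans[of y z])
      show "le (jn x z) (jn z ?u)"
        using assms(2) yz u join_upper1[of z ?u] join_upper2[of z ?u]
        by (intro join_least) (auto intro: trans[of x ?u])
    qed (use assms(2) yz u in auto)
    ultimately show ?thesis by simp
  qed
qed

lemma rk_join_cover:
  assumes "covers A le y z" "x \<in> A"
  shows "rk (jn x y) \<le> rk (jn x z)" "rk (jn x z) \<le> rk (jn x y) + 1"
  using join_cover[OF assms] rk_cover[of "jn x y" "jn x z"] by auto

lemma relpow_cover_rk:
  assumes "x \<in> A" "y \<in> A" "le x y"
  shows "(x, y) \<in> cover_edges A le ^^ nat (rk y - rk x)"
  using assms
proof (induction "nat (rk y - rk x)" arbitrary: x)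
  case 0
  then have "x = y" using rk_strict_mono[of x y] by force
  then show ?case by simp
next
  case (Suc n)
  then have "x \<noteq> y" by auto
  then obtain z where z: "covers A le x z" "le z y" using ex_cover_below Suc.prems by blast
  have zA: "z \<in> A" using coversD[OF z(1)] by simp
  have "n = nat (rk y - rk z)" using Suc.hyps(2) rk_cover[OF z(1)] by simp
  then have "(z, y) \<in> cover_edges A le ^^ n" using Suc.hyps(1) zA z(2) Suc.prems(2) by blast
  moreover have "(x, z) \<in> cover_edges A le" using z(1) by (simp add: cover_edges_def)
  ultimately have "(x, y) \<in> cover_edges A le ^^ Suc n" by (rule relpow_Suc_I2[rotated])
  then show ?case using Suc.hyps(2) by simp
qed

text \<open>Along an edge the quantity \<open>2 * rk (jn x y) - rk y\<close> changes by at most one: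
  a step up raises \<open>rk y\<close> by 1 and the rank of the join by 0 or 1.\<close>

lemma relpow_cover_rk_bound:
  assumes "(x, y) \<in> cover_edges A le ^^ n" "x \<in> A" "y \<in> A"
  shows "2 * rk (jn x y) - rk x - rk y \<le> int n"
  using assms
proof (induction n arbitrary: y)
  case 0
  then show ?case by (simp add: join_absorb refl)
next
  case (Suc n)
  then obtain z where z: "(x, z) \<in> cover_edges A le ^^ n" "(z, y) \<in> cover_edges A le" by auto
  then have zA: "z \<in> A" using cover_edges_in[OF z(2)] by simp
  have IH: "2 * rk (jn x z) - rk x - rk z \<le> int n" by (rule Suc.IH[OF z(1) Suc.prems(2) zA])
  have "covers A le z y \<or> covers A le y z" using z by (auto simp: cover_edges_def)
  then have "2 * rk (jn x y) - rk y \<le> 2 * rk (jn x z) - rk z + 1"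
    using rk_join_cover[of z y x] rk_join_cover[of y z x] Suc.prems rk_cover[of z y] rk_cover[of y z] by auto
  then show ?case using IH by simp
qed

text \<open>Going up to \<open>jn x y\<close> and down again attains the lower bound that holds for
  every path.\<close>

lemma cdist_rk:
  assumes "x \<in> A" "y \<in> A"
  shows "int (cdist A le x y) = 2 * rk (jn x y) - rk x - rk y"
proof (rule order_antisym)
  have "(x, jn x y) \<in> cover_edges A le ^^ nat (rk (jn x y) - rk x)"
    "(y, jn x y) \<in> cover_edges A le ^^ nat (rk (jn x y) - rk y)"
    by (intro relpow_cover_rk assms join_in join_upper1 join_upper2)+
  then have "(x, y) \<in> cover_edges A le ^^ (nat (rk (jn x y) - rk x) + nat (rk (jn x y) - rk y))"
    by (rule cover_edges_relpow_meet)
  then have "cdist A le x y \<le> nat (rk (jn x y) - rk x) + nat (rk (jn x y) - rk y)"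
    by (rule cdist_le[OF assms(1)])
  moreover have "rk x \<le> rk (jn x y)" "rk y \<le> rk (jn x y)"
    using assms by (auto intro!: rk_mono join_upper1 join_upper2)
  ultimately show "int (cdist A le x y) \<le> 2 * rk (jn x y) - rk x - rk y" by linarith
  show "2 * rk (jn x y) - rk x - rk y \<le> int (cdist A le x y)"
    by (rule relpow_cover_rk_bound[OF relpow_cdist[OF assms] assms])
qed

end

text \<open>The length of a longest upward covering path is a corank: two covers \<open>y\<close>, \<open>y'\<close> of
  \<open>x\<close> are both covered by \<open>y \<or> y'\<close>.\<close>

lemma (in finite_length_lattice) ex_corank:
  assumes sm: "upper_semimodular A le"
  obtains k :: "'a \<Rightarrow> nat" where "\<And>x y. covers A le x y \<Longrightarrow> k x = Suc (k y)"
proof -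
  obtain h :: "'a \<Rightarrow> nat" and N where N: "\<And>x. x \<in> A \<Longrightarrow> h x \<le> N"
    and h: "\<And>x y. x \<in> A \<Longrightarrow> y \<in> A \<Longrightarrow> le x y \<Longrightarrow> x \<noteq> y \<Longrightarrow> h x < h y"
    using strict_mono_rank_on_finite_length[OF lattice finite_length] by metis
  define C where "C = {(x, y). covers A le x y}"
  define L where "L x = {n. \<exists>y. (x, y) \<in> C ^^ n}" for x
  define k where "k x = Max (L x)" for x
  have path: "y \<in> A \<and> h x + n \<le> h y" if "(x, y) \<in> C ^^ n" "x \<in> A" for x y n
    using that
  proof (induction n arbitrary: y)
    case (Suc n)
    then obtain z where z: "(x, z) \<in> C ^^ n" "covers A le z y" by (auto simp: C_def)
    then show ?case using Suc.IH[OF z(1) Suc.prems(2)] h[of z y] coversD[OF z(2)] by auto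
  qed auto
  have sub: "L x \<subseteq> {..N}" if "x \<in> A" for x
  proof
    fix n assume "n \<in> L x"
    then obtain y where "(x, y) \<in> C ^^ n" by (auto simp: L_def)
    then show "n \<in> {..N}" using path[of x y n] that N[of y] by auto
  qed
  have fin: "finite (L x)" if "x \<in> A" for x using finite_subset[OF sub[OF that]] by simp
  have "0 \<in> L x" for x by (auto simp: L_def)
  then have ne: "L x \<noteq> {}" for x by blast
  have up: "Suc (k y) \<le> k x" if c: "covers A le x y" for x y
  proof -
    have "k y \<in> L y" unfolding k_def using fin ne coversD[OF c] by (intro Max_in) auto
    then obtain w where "(y, w) \<in> C ^^ k y" by (auto simp: L_def)
    then have "(x, w) \<in> C ^^ Suc (k y)" using c by (intro relpow_Suc_I2) (auto simp: C_def)
    then have "Suc (k y) \<in> L x" by (auto simp: L_def)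
    then show ?thesis unfolding k_def[of x] using fin coversD[OF c] by (intro Max_ge) auto
  qed
  have "k x = Suc (k y)" if "covers A le x y" for x y
    using that
  proof (induction "k x" arbitrary: x y rule: less_induct)
    case less
    have A: "x \<in> A" "y \<in> A" using coversD[OF less.prems] by auto
    have "k x \<in> L x" unfolding k_def using fin ne A by (intro Max_in) auto
    then obtain w where w: "(x, w) \<in> C ^^ k x" by (auto simp: L_def)
    have "k x \<noteq> 0" using up[OF less.prems] by simp
    then obtain m where m: "k x = Suc m" by (cases "k x") auto
    then obtain y' where y': "covers A le x y'" "(y', w) \<in> C ^^ m"
      using w relpow_Suc_D2 unfolding C_def by fastforce
    have A': "y' \<in> A" using coversD[OF y'(1)] by auto
    have "m \<le> k y'" unfolding k_def using y'(2) fin[OF A'] by (intro Max_ge) (auto simp: L_def)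
    then have ky': "k x = Suc (k y')" using up[OF y'(1)] m by linarith
    show ?case
    proof (cases "y = y'")
      case False
      have mt: "mt y y' = x" "mt y' y = x"
      proof -
        have *: "mt u v = x" if "covers A le x u" "covers A le x v" "u \<noteq> v" for u v
        proof -
          have uv: "u \<in> A" "v \<in> A" "le x u" "le x v" using that by (auto simp: covers_def)
          have "le x (mt u v)" using uv A by (intro meet_greatest) auto
          then have "mt u v = x \<or> mt u v = u" "mt u v = x \<or> mt u v = v"
            using coversD(5)[OF that(1), of "mt u v"] coversD(5)[OF that(2), of "mt u v"]
              uv meet_lower1[of u v] meet_lower2[of u v] by auto
          then show ?thesis using that(3) by auto
        qed
        show "mt y y' = x" "mt y' y = x" using * less.prems y'(1) False by auto
      qed
      let ?w = "jn y y'"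
      have "covers A le y' ?w" "covers A le y ?w"
        using sm A A' mt less.prems y'(1) join_commute[of y y']
        unfolding upper_semimodular_def by metis+
      moreover have "k y < k x" "k y' < k x" using up[OF less.prems] ky' by auto
      ultimately have "k y = Suc (k ?w)" "k y' = Suc (k ?w)" using less.hyps by blast+
      then show ?thesis using ky' by simp
    qed (use ky' in simp)
  qed
  then show thesis by (rule that)
qed

section \<open>Breadth at most two\<close>

text \<open>One of the three elements is below every common upper bound of the other two. It cannot
  be \<open>u\<close>, since \<open>v\<close> and \<open>w\<close> are below \<open>c\<close> and
  \<open>u\<close> is not.\<close>

lemma (in lattice_carrier) breadth_le_2_dichotomy:
  assumes b: "n \<le> 2" "has_breadth A le n"
    and A: "u \<in> A" "v \<in> A" "w \<in> A" "c \<in> A" and c: "le v c" "le w c" "\<not> le u c"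
  shows "le v (jn u w) \<or> le w (jn u v)"
proof -
  have "\<not> (\<exists>a. A = {a})" using A c by (auto dest: refl)
  then have n: "0 < n" "breadth_prop A le n" using b by (auto simp: has_breadth_def split: if_splits)
  define F where "F i = (if i = 0 then u else if i = Suc 0 then v else w)" for i
  have F: "F i \<in> A" for i using A by (auto simp: F_def)
  obtain I where I: "I \<subseteq> {..<3}" "card I = n"
    and up: "\<And>w i. w \<in> A \<Longrightarrow> (\<And>i. i \<in> I \<Longrightarrow> le (F i) w) \<Longrightarrow> i < 3 \<Longrightarrow> le (F i) w"
    using breadth_propE[OF n(2,1), of 3 F] b(1) F by auto
  have "I \<noteq> {..<3}" using I(2) b(1) by auto
  then obtain s where s: "s < 3" "s \<notin> I" using I(1) by auto
  have *: "le (F s) z" if "z \<in> A" "\<And>i. i < 3 \<Longrightarrow> i \<noteq> s \<Longrightarrow> le (F i) z" for z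
    using up[of z s] that s I(1) by (metis lessThan_iff subsetD)
  consider "s = 0" | "s = 1" | "s = 2" using s by linarith
  then show ?thesis
  proof cases
    case 1
    have "le (F s) c" by (rule *) (use A c 1 in \<open>auto simp: F_def\<close>)
    then show ?thesis using c 1 by (simp add: F_def)
  next
    case 2
    have "le (F s) (jn u w)"
      by (rule *) (use A 2 in \<open>auto simp: F_def intro: join_upper1 join_upper2\<close>)
    then show ?thesis using 2 by (simp add: F_def)
  next
    case 3
    have "le (F s) (jn u v)"
      by (rule *) (use A 3 in \<open>auto simp: F_def less_Suc_eq numeral_3_eq_3 intro: join_upper1 join_upper2\<close>)
    then show ?thesis using 3 by (simp add: F_def)
  qed
qed

lemma c1_median_property_breadth_le_2:
  assumes lat: "lattice_on A le" and fl: "finite_length A le" and sm: "upper_semimodular A le"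
    and b: "n \<le> 2" "has_breadth A le n"
  shows "c1_median_property A le"
  unfolding c1_median_property_def
proof (intro allI impI)
  interpret finite_length_lattice A le using lat fl by unfold_locales
  obtain k :: "'a \<Rightarrow> nat" where k: "\<And>x y. covers A le x y \<Longrightarrow> k x = Suc (k y)"
    using ex_corank[OF sm] by blast
  define rk where "rk x = - int (k x)" for x
  interpret graded_semimodular_lattice A le rk
    using sm k by unfold_locales (auto simp: rk_def)
  fix xi y assume xi: "xi \<noteq> [] \<and> set xi \<subseteq> A" and med: "is_median A le xi y"
  define c where "c = c1 A le xi"
  define S where "S = {i. i < length xi \<and> le (xi ! i) y}"
  define T where "T = {i. i < length xi \<and> \<not> le (xi ! i) y}"
  have ST: "finite S" "finite T" "S \<inter> T = {}" "{..<length xi} = S \<union> T" by (auto simp: S_def T_def)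
  have yA: "y \<in> A" using med by (simp add: is_median_def)
  have xA: "xi ! i \<in> A" if "i < length xi" for i using xi that nth_mem by blast
  have cA: "c \<in> A" and xc: "i < length xi \<Longrightarrow> le (xi ! i) c" for i
    unfolding c_def c1_def using xi by (auto intro!: Join_in Join_upper)
  have rem: "int (remoteness A le z xi) =
      (\<Sum>i\<in>S. int (cdist A le z (xi ! i))) + (\<Sum>i\<in>T. int (cdist A le z (xi ! i)))" for z
    unfolding remoteness_def by (simp add: ST sum.union_disjoint)
  show "le y (c1 A le xi)"
  proof (rule ccontr)
    assume "\<not> le y (c1 A le xi)"
    then have yc: "\<not> le y c" by (simp add: c_def)
    have half: "card T \<le> card S"
    proof (cases "T = {}")
      case False
      define f where "f i = rk (jn y (xi ! i))" for i
      have "Min (f ` T) \<in> f ` T" using ST(2) False by (intro Min_in) auto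
      then obtain m where m: "m \<in> T" "Min (f ` T) = f m" by blast
      have min: "rk (jn y (xi ! m)) \<le> rk (jn y (xi ! i))" if "i \<in> T" for i
        using Min_le[of "f ` T" "f i"] ST(2) m(2) that unfolding f_def[symmetric] by simp
      have mA: "xi ! m \<in> A" "m < length xi" and my: "\<not> le (xi ! m) y" using m xA by (auto simp: T_def)
      \<comment> \<open>The join with index \<open>m\<close> is comparable with each of the others
        and has the smallest rank, so it is the least.\<close>
      have chain: "le (jn y (xi ! m)) (jn y (xi ! i))" if i: "i \<in> T" for i
      proof -
        have iA: "xi ! i \<in> A" "i < length xi" using i xA by (auto simp: T_def)
        consider "le (xi ! m) (jn y (xi ! i))" | "le (xi ! i) (jn y (xi ! m))"
          using breadth_le_2_dichotomy[OF b yA mA(1) iA(1) cA] xc yc mA iA by blast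
        then show ?thesis
        proof cases
          case 1
          then show ?thesis using yA mA iA by (intro join_least) (auto intro: join_upper1)
        next
          case 2
          then have "le (jn y (xi ! i)) (jn y (xi ! m))"
            using yA mA iA by (intro join_least) (auto intro: join_upper1)
          then have "jn y (xi ! i) = jn y (xi ! m)"
            using rk_strict_mono[of "jn y (xi ! i)" "jn y (xi ! m)"] min[OF i] yA mA iA by force
          then show ?thesis using refl yA mA by simp
        qed
      qed
      have "y \<noteq> jn y (xi ! m)" using my yA mA join_upper2[of y "xi ! m"] by auto
      then obtain y' where y': "covers A le y y'" "le y' (jn y (xi ! m))"
        using ex_cover_below[of y "jn y (xi ! m)"] yA mA join_upper1 by auto
      have y'A: "y' \<in> A" "le y y'" using y' by (auto simp: covers_def)
      have "int (cdist A le y' (xi ! i)) \<le> int (cdist A le y (xi ! i)) + 1" if "i \<in> S" for i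
        using cdist_edge[of y' y "xi ! i"] y' that xA by (auto simp: cover_edges_def S_def)
      then have 1: "(\<Sum>i\<in>S. int (cdist A le y' (xi ! i))) \<le> (\<Sum>i\<in>S. int (cdist A le y (xi ! i)) + 1)"
        by (rule sum_mono)
      \<comment> \<open>\<open>y'\<close> is below \<open>jn y (xi ! i)\<close>, so the join with
        \<open>xi ! i\<close> stays the same while the rank of the first point grows by one.\<close>
      have "int (cdist A le y' (xi ! i)) = int (cdist A le y (xi ! i)) - 1" if "i \<in> T" for i
      proof -
        have iA: "xi ! i \<in> A" using that xA by (auto simp: T_def)
        have "le y' (jn y (xi ! i))"
          using y' y'A chain[OF that] yA mA iA by (auto intro: trans[of y' "jn y (xi ! m)"])
        then have "le (jn y' (xi ! i)) (jn y (xi ! i))"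
          using y'A yA iA by (intro join_least) (auto intro: join_upper2)
        moreover have "le (jn y (xi ! i)) (jn y' (xi ! i))"
          using y'A yA iA
          by (intro join_least) (auto intro: join_upper2 join_upper1 trans[of y y'])
        ultimately have "jn y' (xi ! i) = jn y (xi ! i)" using y'A yA iA by (intro antisym) auto
        then show ?thesis using cdist_rk[of y' "xi ! i"] cdist_rk[of y "xi ! i"] y'A yA iA rk_cover[OF y'(1)]
          by simp
      qed
      then have 2: "(\<Sum>i\<in>T. int (cdist A le y' (xi ! i))) = (\<Sum>i\<in>T. int (cdist A le y (xi ! i)) - 1)"
        by (rule sum.cong[OF HOL.refl])
      \<comment> \<open>Replacing \<open>y\<close> by \<open>y'\<close> saves exactly
        \<open>card T\<close> and costs at most \<open>card S\<close>, and a median cannot be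
        improved.\<close>
      have "int (remoteness A le y xi) \<le> int (remoteness A le y' xi)"
        using med y'A by (simp add: is_median_def)
      then have "int (card T) \<le> int (card S)"
        using 1 2 unfolding rem by (simp add: sum.distrib sum_subtractf)
      then show ?thesis by simp
    qed simp
    define z where "z = mt y c"
    have zA: "z \<in> A" "le z y" "le z c" unfolding z_def using yA cA meet_lower1 meet_lower2 by auto
    define d where "d = rk y - rk z"
    have "z \<noteq> y" using zA yc by auto
    then have d: "0 < d" unfolding d_def using rk_strict_mono[OF zA(1) yA zA(2)] by simp
    have "int (cdist A le z (xi ! i)) = int (cdist A le y (xi ! i)) - d" if "i \<in> S" for i
    proof -
      have i: "xi ! i \<in> A" "le (xi ! i) y" "le (xi ! i) c" using that xA xc by (auto simp: S_def)
      then have "le (xi ! i) z" unfolding z_def using yA cA by (intro meet_greatest)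
      then have "jn z (xi ! i) = z" "jn y (xi ! i) = y"
        using i zA yA join_absorb[of "xi ! i"] join_commute by metis+
      then show ?thesis
        using cdist_rk[of z "xi ! i"] cdist_rk[of y "xi ! i"] i zA yA by (simp add: d_def)
    qed
    then have 1: "(\<Sum>i\<in>S. int (cdist A le z (xi ! i))) = (\<Sum>i\<in>S. int (cdist A le y (xi ! i)) - d)"
      by (rule sum.cong[OF HOL.refl])
    \<comment> \<open>Lowering the rank of the point by \<open>d\<close> costs \<open>d\<close>. The
      join with \<open>xi ! i\<close> changes from an element not below \<open>c\<close> to one
      below \<open>c\<close> and so loses at least one rank, which saves 2.\<close>
    have "int (cdist A le z (xi ! i)) \<le> int (cdist A le y (xi ! i)) + (d - 2)" if "i \<in> T" for i
    proof -
      have i: "xi ! i \<in> A" "le (xi ! i) c" using that xA xc by (auto simp: T_def)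
      have "le (jn z (xi ! i)) c" using i zA cA by (intro join_least)
      moreover have "\<not> le (jn y (xi ! i)) c"
        using yc join_upper1[OF yA i(1)] trans[of y "jn y (xi ! i)" c] yA i cA by auto
      ultimately have ne: "jn z (xi ! i) \<noteq> jn y (xi ! i)" by auto
      have "le (jn z (xi ! i)) (jn y (xi ! i))"
        using zA yA i by (intro join_least) (auto intro: join_upper2 join_upper1 trans[of z y])
      then have "rk (jn z (xi ! i)) < rk (jn y (xi ! i))"
        using ne zA yA i by (intro rk_strict_mono) auto
      then show ?thesis
        using cdist_rk[of z "xi ! i"] cdist_rk[of y "xi ! i"] i zA yA by (simp add: d_def)
    qed
    then have 2: "(\<Sum>i\<in>T. int (cdist A le z (xi ! i))) \<le> (\<Sum>i\<in>T. int (cdist A le y (xi ! i)) + (d - 2))"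
      by (rule sum_mono)
    have "int (remoteness A le y xi) \<le> int (remoteness A le z xi)"
      using med zA by (simp add: is_median_def)
    \<comment> \<open>Combined with \<open>half\<close>, this inequality forces
      \<open>card T = 0\<close> and then \<open>card S = 0\<close>, which is impossible for a
      nonempty profile.\<close>
    then have "int (card S) * d \<le> int (card T) * (d - 2)"
      using 1 2 unfolding rem by (simp add: sum.distrib sum_subtractf)
    also have "\<dots> \<le> int (card S) * d - 2 * int (card T)"
      using mult_right_mono[of "int (card T)" "int (card S)" d] half d by (simp add: algebra_simps)
    finally have "card T = 0" by simp
    then have "int (card S) * d \<le> 0"
      using \<open>int (card S) * d \<le> int (card T) * (d - 2)\<close> by simp
    then have "card S = 0" using d by (simp add: mult_le_0_iff)
    then have "{..<length xi} = {}" using \<open>card T = 0\<close> ST by simp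
    then show False using xi by (auto simp: lessThan_empty_iff)
  qed
qed

section \<open>Direct products\<close>

locale lattice_product =
  fixes t :: nat and A :: "nat \<Rightarrow> 'a set" and le :: "nat \<Rightarrow> 'a \<Rightarrow> 'a \<Rightarrow> bool"
  assumes factor_lattice: "i < t \<Longrightarrow> lattice_on (A i) (le i)"
    and factor_finite_length: "i < t \<Longrightarrow> finite_length (A i) (le i)"
begin

abbreviation P where "P \<equiv> prod_carrier t A"
abbreviation ple where "ple \<equiv> prod_le t le"
abbreviation proj where "proj i \<equiv> map (\<lambda>X :: nat \<Rightarrow> 'a. X i)"

lemma factor: "i < t \<Longrightarrow> finite_length_lattice (A i) (le i)"
  using factor_lattice factor_finite_length
  by (simp add: finite_length_lattice_def lattice_carrier_def finite_length_lattice_axioms_def)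

lemma factor_carrier: "i < t \<Longrightarrow> lattice_carrier (A i) (le i)"
  using factor_lattice by (simp add: lattice_carrier_def)

lemma component_in [simp]: "X \<in> P \<Longrightarrow> i < t \<Longrightarrow> X i \<in> A i"
  by (auto simp: prod_carrier_def)

lemma restrict_in: "(\<And>i. i < t \<Longrightarrow> f i \<in> A i) \<Longrightarrow> restrict f {..<t} \<in> P"
  by (auto simp: prod_carrier_def)

lemma update_in: "X \<in> P \<Longrightarrow> i < t \<Longrightarrow> a \<in> A i \<Longrightarrow> X(i := a) \<in> P"
  by (auto simp: prod_carrier_def PiE_iff extensional_def)

lemma product_eqI: "X \<in> P \<Longrightarrow> Y \<in> P \<Longrightarrow> (\<And>i. i < t \<Longrightarrow> X i = Y i) \<Longrightarrow> X = Y"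
  unfolding prod_carrier_def by (rule PiE_ext) auto

section \<open>Order, joins and finite length of the product\<close>

lemma product_lub:
  assumes "Z \<in> P" "\<And>i. i < t \<Longrightarrow> is_lub (A i) (le i) ((\<lambda>X. X i) ` S) (Z i)"
  shows "is_lub P ple S Z"
  using assms by (fastforce simp: is_lub_def prod_le_def)

lemma product_glb:
  assumes "Z \<in> P" "\<And>i. i < t \<Longrightarrow> is_glb (A i) (le i) ((\<lambda>X. X i) ` S) (Z i)"
  shows "is_glb P ple S Z"
  using assms by (fastforce simp: is_glb_def prod_le_def)

lemma product_join_lub:
  assumes "X \<in> P" "Y \<in> P"
  shows "is_lub P ple {X, Y} (restrict (\<lambda>i. join (A i) (le i) (X i) (Y i)) {..<t})"
  using assms by (intro product_lub restrict_in)
    (simp_all add: lattice_carrier.join_in lattice_carrier.join_is_lub factor_carrier)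

lemma product_meet_glb:
  assumes "X \<in> P" "Y \<in> P"
  shows "is_glb P ple {X, Y} (restrict (\<lambda>i. meet (A i) (le i) (X i) (Y i)) {..<t})"
  using assms by (intro product_glb restrict_in)
    (simp_all add: lattice_carrier.meet_in lattice_carrier.meet_is_glb factor_carrier)

lemma product_lattice: "lattice_on P ple"
  unfolding lattice_on_def
proof (intro conjI ballI impI)
  have "\<exists>a. a \<in> A i" if "i < t" for i
    using lattice_carrier.nonempty[OF factor_carrier[OF that]] by blast
  then have "restrict (\<lambda>i. SOME a. a \<in> A i) {..<t} \<in> P" by (intro restrict_in) (rule someI_ex)
  then show "P \<noteq> {}" by blast
  show "ple X X" if "X \<in> P" for X
    using that by (simp add: prod_le_def lattice_carrier.refl[OF factor_carrier])
  show "X = Y" if "X \<in> P" "Y \<in> P" "ple X Y \<and> ple Y X" for X Y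
    using that by (intro product_eqI) (auto simp: prod_le_def intro: lattice_carrier.antisym[OF factor_carrier])
  show "ple X Z" if "X \<in> P" "Y \<in> P" "Z \<in> P" "ple X Y \<and> ple Y Z" for X Y Z
    unfolding prod_le_def
  proof (intro allI impI)
    fix i assume i: "i < t"
    show "le i (X i) (Z i)"
      by (rule lattice_carrier.trans[OF factor_carrier[OF i], of _ "Y i"])
        (use that i in \<open>auto simp: prod_le_def\<close>)
  qed
qed (use product_join_lub product_meet_glb in blast)+

text \<open>Strictly increasing bounded functions on the factors add up to one on the
  product.\<close>

lemma product_finite_length: "finite_length P ple"
proof -
  have "\<forall>i. \<exists>hN :: ('a \<Rightarrow> nat) \<times> nat. i < t \<longrightarrow> (\<forall>x\<in>A i. fst hN x \<le> snd hN) \<and>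
    (\<forall>x\<in>A i. \<forall>y\<in>A i. le i x y \<and> x \<noteq> y \<longrightarrow> fst hN x < fst hN y)"
  proof
    fix i
    show "\<exists>hN :: ('a \<Rightarrow> nat) \<times> nat. i < t \<longrightarrow> (\<forall>x\<in>A i. fst hN x \<le> snd hN) \<and>
      (\<forall>x\<in>A i. \<forall>y\<in>A i. le i x y \<and> x \<noteq> y \<longrightarrow> fst hN x < fst hN y)"
    proof (cases "i < t")
      case True
      obtain h :: "'a \<Rightarrow> nat" and N where "\<And>x. x \<in> A i \<Longrightarrow> h x \<le> N"
        "\<And>x y. x \<in> A i \<Longrightarrow> y \<in> A i \<Longrightarrow> le i x y \<Longrightarrow> x \<noteq> y \<Longrightarrow> h x < h y"
        using strict_mono_rank_on_finite_length[OF factor_lattice[OF True] factor_finite_length[OF True]]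
        by metis
      then show ?thesis by (intro exI[of _ "(h, N)"]) auto
    qed auto
  qed
  from choice[OF this] obtain hN :: "nat \<Rightarrow> ('a \<Rightarrow> nat) \<times> nat" where hN:
    "\<And>i x. i < t \<Longrightarrow> x \<in> A i \<Longrightarrow> fst (hN i) x \<le> snd (hN i)"
    "\<And>i x y. i < t \<Longrightarrow> x \<in> A i \<Longrightarrow> y \<in> A i \<Longrightarrow> le i x y \<Longrightarrow> x \<noteq> y \<Longrightarrow> fst (hN i) x < fst (hN i) y"
    by blast
  have mono: "fst (hN i) x \<le> fst (hN i) y" if "i < t" "x \<in> A i" "y \<in> A i" "le i x y" for i x y
    using hN(2)[OF that] by (cases "x = y") auto
  show ?thesis
  proof (rule finite_lengthI[of _ "\<lambda>X. \<Sum>i<t. fst (hN i) (X i)" "\<Sum>i<t. snd (hN i)"])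
    show "(\<Sum>i<t. fst (hN i) (X i)) \<le> (\<Sum>i<t. snd (hN i))" if "X \<in> P" for X
      using hN(1) that by (intro sum_mono) auto
    show "(\<Sum>i<t. fst (hN i) (X i)) < (\<Sum>i<t. fst (hN i) (Y i))"
      if XY: "X \<in> P" "Y \<in> P" "ple X Y" "X \<noteq> Y" for X Y
    proof (rule sum_strict_mono_ex1)
      show "\<forall>i\<in>{..<t}. fst (hN i) (X i) \<le> fst (hN i) (Y i)"
        using XY by (auto simp: prod_le_def intro!: mono)
      obtain i where "i < t" "X i \<noteq> Y i" using XY product_eqI by blast
      then show "\<exists>i\<in>{..<t}. fst (hN i) (X i) < fst (hN i) (Y i)"
        using XY by (intro bexI[of _ i] hN(2)) (auto simp: prod_le_def)
    qed simp
  qed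
qed

sublocale product: finite_length_lattice P ple
  using product_lattice product_finite_length by unfold_locales

lemma product_join: "X \<in> P \<Longrightarrow> Y \<in> P \<Longrightarrow> i < t \<Longrightarrow> join P ple X Y i = join (A i) (le i) (X i) (Y i)"
  using product.join_eqI[OF product_join_lub] by simp

lemma product_meet: "X \<in> P \<Longrightarrow> Y \<in> P \<Longrightarrow> i < t \<Longrightarrow> meet P ple X Y i = meet (A i) (le i) (X i) (Y i)"
  using product.meet_eqI[OF product_meet_glb] by simp

section \<open>Covers and distances in the product\<close>

lemma product_coversI:
  assumes X: "X \<in> P" and i: "i < t" and c: "covers (A i) (le i) (X i) b"
  shows "covers P ple X (X(i := b))"
  unfolding covers_def
proof (intro conjI ballI impI)
  show Y: "X(i := b) \<in> P" using c by (intro update_in X i) (auto simp: covers_def)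
  show "ple X (X(i := b))"
    using X c by (auto simp: prod_le_def covers_def lattice_carrier.refl[OF factor_carrier])
  show "X \<noteq> X(i := b)" using c by (metis coversD(4) fun_upd_same)
  fix Z assume Z: "Z \<in> P" "ple X Z \<and> ple Z (X(i := b))"
  have off: "Z j = X j" if "j < t" "j \<noteq> i" for j
    using Z X that by (intro lattice_carrier.antisym[OF factor_carrier, of j]) (auto simp: prod_le_def split: if_splits)
  have "Z i = X i \<or> Z i = b"
    using coversD(5)[OF c, of "Z i"] Z i by (auto simp: prod_le_def)
  then show "Z = X \<or> Z = X(i := b)"
    using off product_eqI[OF Z(1) X] product_eqI[OF Z(1) Y] by (metis fun_upd_apply)
qed (rule X)

text \<open>If \<open>X\<close> and \<open>Y\<close> differ at \<open>i\<close>, then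
  \<open>X(i := Y i)\<close> lies between them and is not \<open>X\<close>, so it is
  \<open>Y\<close>: a cover changes a single coordinate.\<close>

lemma product_coversE:
  assumes c: "covers P ple X Y"
  obtains i where "i < t" "covers (A i) (le i) (X i) (Y i)" "Y = X(i := Y i)"
proof -
  have XY: "X \<in> P" "Y \<in> P" "ple X Y" "X \<noteq> Y" using coversD[OF c] by auto
  then obtain i where i: "i < t" "X i \<noteq> Y i" using product_eqI by blast
  have "X(i := Y i) \<in> P" using XY i by (intro update_in) auto
  moreover have "ple X (X(i := Y i))" "ple (X(i := Y i)) Y"
    using XY i by (auto simp: prod_le_def lattice_carrier.refl[OF factor_carrier])
  ultimately have "X(i := Y i) = X \<or> X(i := Y i) = Y" using coversD(5)[OF c] by blast
  then have Y: "Y = X(i := Y i)" using i(2) by (metis fun_upd_same)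
  have "covers (A i) (le i) (X i) (Y i)"
    unfolding covers_def
  proof (intro conjI ballI impI)
    fix z assume z: "z \<in> A i" "le i (X i) z \<and> le i z (Y i)"
    have "X(i := z) \<in> P" using XY z i by (intro update_in) auto
    moreover have "ple X (X(i := z))"
      using XY z by (auto simp: prod_le_def lattice_carrier.refl[OF factor_carrier])
    moreover have "ple (X(i := z)) Y"
      using XY z by (auto simp: prod_le_def)
    ultimately have "X(i := z) = X \<or> X(i := z) = Y" using coversD(5)[OF c] by blast
    then show "z = X i \<or> z = Y i" by (metis fun_upd_same)
  qed (use XY i in \<open>auto simp: prod_le_def\<close>)
  then show thesis using that i(1) Y by blast
qed

lemma product_edgeI:
  assumes "X \<in> P" "i < t" "(X i, b) \<in> cover_edges (A i) (le i)"
  shows "(X, X(i := b)) \<in> cover_edges P ple"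
proof -
  have b: "b \<in> A i" using cover_edges_in[OF assms(3)] by simp
  consider "covers (A i) (le i) (X i) b" | "covers (A i) (le i) b (X i)"
    using assms(3) by (auto simp: cover_edges_def)
  then show ?thesis
  proof cases
    case 1
    then show ?thesis using product_coversI[OF assms(1,2)] by (simp add: cover_edges_def)
  next
    case 2
    then have "covers P ple (X(i := b)) X"
      using product_coversI[OF update_in[OF assms(1,2) b] assms(2), of "X i"] by simp
    then show ?thesis by (simp add: cover_edges_def)
  qed
qed

lemma product_edgeE:
  assumes "(X, Y) \<in> cover_edges P ple"
  obtains i where "i < t" "(X i, Y i) \<in> cover_edges (A i) (le i)" "\<And>j. j \<noteq> i \<Longrightarrow> Y j = X j"
proof -
  consider "covers P ple X Y" | "covers P ple Y X" using assms by (auto simp: cover_edges_def)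
  then show thesis
  proof cases
    case 1
    then obtain i where "i < t" "covers (A i) (le i) (X i) (Y i)" "Y = X(i := Y i)"
      by (rule product_coversE)
    then show thesis using that[of i] by (metis (mono_tags, lifting) cover_edges_def case_prodI fun_upd_other mem_Collect_eq)
  next
    case 2
    then obtain i where "i < t" "covers (A i) (le i) (Y i) (X i)" "X = Y(i := X i)"
      by (rule product_coversE)
    then show thesis using that[of i] by (metis (mono_tags, lifting) cover_edges_def case_prodI fun_upd_other mem_Collect_eq)
  qed
qed

lemma product_relpow_component:
  assumes "X \<in> P" "i < t" "(X i, b) \<in> cover_edges (A i) (le i) ^^ n"
  shows "(X, X(i := b)) \<in> cover_edges P ple ^^ n"
  using assms(3)
proof (induction n arbitrary: b)
  case (Suc n)
  then obtain c where c: "(X i, c) \<in> cover_edges (A i) (le i) ^^ n" "(c, b) \<in> cover_edges (A i) (le i)" by auto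
  have "X(i := c) \<in> P" using cover_edges_in[OF c(2)] assms by (intro update_in) auto
  then have "(X(i := c), X(i := b)) \<in> cover_edges P ple"
    using product_edgeI[of "X(i := c)" i b] assms(2) c(2) by simp
  with Suc.IH[OF c(1)] show ?case by (rule relpow_Suc_I)
qed simp

text \<open>The coordinates are moved one after the other, each along a shortest path of its
  factor.\<close>

lemma product_relpow:
  assumes "X \<in> P" "Y \<in> P" "s \<le> t"
  shows "(X, \<lambda>j. if j < s then Y j else X j) \<in> cover_edges P ple ^^ (\<Sum>i<s. cdist (A i) (le i) (X i) (Y i))"
  using assms(3)
proof (induction s)
  case (Suc s)
  let ?Z = "\<lambda>s j. if j < s then Y j else X j"
  have s: "s < t" using Suc.prems by simp
  have "?Z s \<in> P" using assms s by (auto simp: prod_carrier_def PiE_iff extensional_def)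
  moreover have "(X s, Y s) \<in> cover_edges (A s) (le s) ^^ cdist (A s) (le s) (X s) (Y s)"
    using assms s by (intro finite_length_lattice.relpow_cdist factor) auto
  ultimately have "(?Z s, (?Z s)(s := Y s)) \<in> cover_edges P ple ^^ cdist (A s) (le s) (X s) (Y s)"
    using s by (intro product_relpow_component) auto
  moreover have "(?Z s)(s := Y s) = ?Z (Suc s)" by (auto simp: less_Suc_eq)
  ultimately show ?case using Suc by (auto simp: relpow_add)
qed simp

text \<open>An edge of the product moves one coordinate along an edge of its factor and so lowers
  the sum of the distances by at most one.\<close>

lemma product_relpow_bound:
  assumes "(X, Y) \<in> cover_edges P ple ^^ n" "Y \<in> P"
  shows "(\<Sum>i<t. cdist (A i) (le i) (X i) (Y i)) \<le> n"
  using assms(1)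
proof (induction n arbitrary: X)
  case 0
  then show ?case using assms(2) by (simp add: finite_length_lattice.cdist_self[OF factor])
next
  case (Suc n)
  obtain Z where Z: "(X, Z) \<in> cover_edges P ple" "(Z, Y) \<in> cover_edges P ple ^^ n"
    using relpow_Suc_D2[OF Suc.prems] by blast
  obtain k where k: "k < t" "(X k, Z k) \<in> cover_edges (A k) (le k)" "\<And>j. j \<noteq> k \<Longrightarrow> Z j = X j"
    using product_edgeE[OF Z(1)] by blast
  let ?d = "\<lambda>W i. cdist (A i) (le i) (W i) (Y i)"
  have "?d X k \<le> Suc (?d Z k)"
    using k assms(2) by (intro finite_length_lattice.cdist_edge factor) auto
  then have "sum (?d X) {..<t} \<le> Suc (sum (?d Z) {..<t})"
    using k by (simp add: sum.remove[of "{..<t}" k])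
  then show ?case using Suc.IH[OF Z(2)] by simp
qed

lemma product_cdist:
  assumes "X \<in> P" "Y \<in> P"
  shows "cdist P ple X Y = (\<Sum>i<t. cdist (A i) (le i) (X i) (Y i))"
proof (rule order_antisym)
  have "(\<lambda>j. if j < t then Y j else X j) = Y"
    using assms by (auto simp: prod_carrier_def PiE_iff extensional_def)
  then have "(X, Y) \<in> cover_edges P ple ^^ (\<Sum>i<t. cdist (A i) (le i) (X i) (Y i))"
    using product_relpow[OF assms order_refl] by simp
  then show "cdist P ple X Y \<le> (\<Sum>i<t. cdist (A i) (le i) (X i) (Y i))"
    by (rule cdist_le[OF assms(1)])
  show "(\<Sum>i<t. cdist (A i) (le i) (X i) (Y i)) \<le> cdist P ple X Y"
    by (rule product_relpow_bound[OF product.relpow_cdist[OF assms] assms(2)])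
qed

section \<open>Medians in the product\<close>

lemma product_remoteness:
  assumes "Y \<in> P" "set xi \<subseteq> P"
  shows "remoteness P ple Y xi = (\<Sum>i<t. remoteness (A i) (le i) (Y i) (proj i xi))"
proof -
  have "remoteness P ple Y xi = (\<Sum>j<length xi. \<Sum>i<t. cdist (A i) (le i) (Y i) ((xi ! j) i))"
    unfolding remoteness_def
    using assms by (intro sum.cong HOL.refl product_cdist) (auto simp: subset_iff)
  also have "\<dots> = (\<Sum>i<t. \<Sum>j<length xi. cdist (A i) (le i) (Y i) ((xi ! j) i))"
    by (rule sum.swap)
  finally show ?thesis by (simp add: remoteness_def)
qed

text \<open>Changing only coordinate \<open>i\<close> of a median leaves the other summands of the
  remoteness as they are, so this coordinate must be optimal in its factor.\<close>

lemma product_median_component: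
  assumes "is_median P ple xi Y" "set xi \<subseteq> P" "i < t"
  shows "is_median (A i) (le i) (proj i xi) (Y i)"
  unfolding is_median_def
proof (intro conjI ballI)
  have Y: "Y \<in> P" using assms(1) by (simp add: is_median_def)
  then show "Y i \<in> A i" using assms(3) by simp
  fix z assume "z \<in> A i"
  then have Z: "Y(i := z) \<in> P" using Y assms(3) by (intro update_in)
  have "remoteness P ple Y xi \<le> remoteness P ple (Y(i := z)) xi"
    using assms(1) Z by (simp add: is_median_def)
  then show "remoteness (A i) (le i) (Y i) (proj i xi) \<le> remoteness (A i) (le i) z (proj i xi)"
    using assms(3) by (simp add: product_remoteness Y Z assms(2) sum.remove[of "{..<t}" i])
qed

lemma product_medianI:
  assumes "Y \<in> P" "set xi \<subseteq> P" "\<And>i. i < t \<Longrightarrow> is_median (A i) (le i) (proj i xi) (Y i)"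
  shows "is_median P ple xi Y"
  using assms by (auto simp: is_median_def product_remoteness intro!: sum_mono)

lemma product_c1:
  assumes "xi \<noteq> []" "set xi \<subseteq> P" "i < t"
  shows "c1 P ple xi i = c1 (A i) (le i) (proj i xi)"
proof -
  let ?Z = "restrict (\<lambda>i. c1 (A i) (le i) (proj i xi)) {..<t}"
  have lub: "is_lub (A i) (le i) (set (proj i xi)) (c1 (A i) (le i) (proj i xi))" if "i < t" for i
    unfolding c1_def using assms that
    by (intro lattice_carrier.Join_is_lub factor_carrier) auto
  then have "?Z \<in> P" by (intro restrict_in) (auto simp: is_lub_def)
  then have "is_lub P ple (set xi) ?Z" using lub by (intro product_lub) auto
  then show ?thesis using assms(3) product.Join_eqI unfolding c1_def by fastforce
qed

lemma product_c1_median_property: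
  assumes "\<And>i. i < t \<Longrightarrow> c1_median_property (A i) (le i)"
  shows "c1_median_property P ple"
  unfolding c1_median_property_def
proof (intro allI impI)
  fix xi Y assume xi: "xi \<noteq> [] \<and> set xi \<subseteq> P" and med: "is_median P ple xi Y"
  have "le i (Y i) (c1 (A i) (le i) (proj i xi))" if "i < t" for i
  proof -
    have "proj i xi \<noteq> [] \<and> set (proj i xi) \<subseteq> A i" using xi that by (auto dest: subsetD)
    moreover have "is_median (A i) (le i) (proj i xi) (Y i)"
      using product_median_component[OF med _ that] xi by blast
    ultimately show ?thesis using assms[OF that, unfolded c1_median_property_def] by simp
  qed
  then show "ple Y (c1 P ple xi)" using xi by (simp add: prod_le_def product_c1)
qed

text \<open>Serves to pass a counterexample from one factor to the product. The profile is padded by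
  a fixed \<open>B\<close>: in every other coordinate it is constant, and there the constant value
  is a median, of remoteness 0.\<close>

lemma product_c1_median_propertyD:
  assumes c: "c1_median_property P ple" and k: "k < t"
  shows "c1_median_property (A k) (le k)"
  unfolding c1_median_property_def
proof (intro allI impI)
  fix xi y assume xi: "xi \<noteq> [] \<and> set xi \<subseteq> A k" and med: "is_median (A k) (le k) xi y"
  obtain B where B: "B \<in> P" using product.nonempty by blast
  let ?xi = "map (\<lambda>x. B(k := x)) xi"
  have y: "y \<in> A k" using med by (simp add: is_median_def)
  have Y: "B(k := y) \<in> P" using B k y by (rule update_in)
  have xiP: "set ?xi \<subseteq> P" using B k xi by (auto intro: update_in)
  have proj: "proj i ?xi = (if i = k then xi else replicate (length xi) (B i))" for i
    by (auto simp: map_replicate_const comp_def)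
  have "is_median P ple ?xi (B(k := y))"
  proof (rule product_medianI[OF Y xiP])
    fix i assume i: "i < t"
    show "is_median (A i) (le i) (proj i ?xi) ((B(k := y)) i)"
    proof (cases "i = k")
      case False
      then have "remoteness (A i) (le i) (B i) (proj i ?xi) = 0"
        using i B finite_length_lattice.cdist_self[OF factor[OF i]] unfolding proj
        by (simp add: remoteness_def)
      then show ?thesis using False i B by (simp add: is_median_def)
    qed (use med in \<open>simp only: proj fun_upd_same simp_thms if_True\<close>)
  qed
  then have "ple (B(k := y)) (c1 P ple ?xi)"
    using c xi xiP unfolding c1_median_property_def by simp
  then have "le k y (c1 P ple ?xi k)" using k by (auto simp: prod_le_def)
  then show "le k y (c1 (A k) (le k) xi)"
    using product_c1[of ?xi k] xi xiP k by (simp add: comp_def)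
qed

text \<open>The cover changes one coordinate \<open>i\<close>. In every other coordinate
  \<open>X\<close> agrees with the meet and hence lies below \<open>Y\<close>, so the join differs
  from \<open>Y\<close> only at \<open>i\<close>, where semimodularity of the factor
  applies.\<close>

lemma product_upper_semimodular:
  assumes sm: "\<And>i. i < t \<Longrightarrow> upper_semimodular (A i) (le i)"
  shows "upper_semimodular P ple"
  unfolding upper_semimodular_def
proof (intro ballI impI)
  fix X Y assume XY: "X \<in> P" "Y \<in> P" and c: "covers P ple (meet P ple X Y) X"
  obtain i where i: "i < t" "covers (A i) (le i) (meet P ple X Y i) (X i)"
    and eq: "X = (meet P ple X Y)(i := X i)" using product_coversE[OF c] by blast
  have "covers (A i) (le i) (Y i) (join (A i) (le i) (X i) (Y i))"
    using sm[OF i(1)] i XY unfolding upper_semimodular_def by (simp add: product_meet)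
  then have cov: "covers P ple Y (Y(i := join (A i) (le i) (X i) (Y i)))"
    using product_coversI[OF XY(2) i(1)] by blast
  have "join (A j) (le j) (X j) (Y j) = Y j" if j: "j < t" "j \<noteq> i" for j
  proof -
    interpret lattice_carrier "A j" "le j" using j by (intro factor_carrier)
    have "X j = meet P ple X Y j" using j by (subst eq) simp
    then have "X j = meet (A j) (le j) (X j) (Y j)" using XY j by (simp add: product_meet)
    then have "le j (X j) (Y j)" using meet_lower2[of "X j" "Y j"] XY j by simp
    then show ?thesis using XY j by (intro join_absorb) auto
  qed
  then have "join P ple X Y = Y(i := join (A i) (le i) (X i) (Y i))"
    using XY i coversD(2)[OF cov] by (intro product_eqI) (auto simp: product_join)
  then show "covers P ple Y (join P ple X Y)" using cov by simp
qed

section \<open>Breadth of the product\<close>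

lemma product_singleton_iff: "(\<exists>X. P = {X}) \<longleftrightarrow> (\<forall>i<t. \<exists>a. A i = {a})"
proof
  assume "\<exists>X. P = {X}"
  then obtain X where X: "P = {X}" ..
  show "\<forall>i<t. \<exists>a. A i = {a}"
  proof (intro allI impI exI)
    fix i assume i: "i < t"
    have "a = X i" if "a \<in> A i" for a
      using update_in[of X i a] X i that by (metis fun_upd_same insertI1 singletonD)
    then show "A i = {X i}" using component_in[of X i] X i by auto
  qed
next
  assume a: "\<forall>i<t. \<exists>a. A i = {a}"
  obtain X where X: "X \<in> P" using product.nonempty by blast
  have "Y = X" if "Y \<in> P" for Y
  proof (rule product_eqI[OF that X])
    fix i assume i: "i < t"
    then obtain a where "A i = {a}" using a by blast
    then show "Y i = X i" using component_in[OF X i] component_in[OF that i] by simp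
  qed
  then show "\<exists>X. P = {X}" using X by blast
qed

text \<open>The union of sufficient index sets for the factors suffices for the product; overlaps
  are harmless by \<open>breadth_propI\<close>.\<close>

lemma product_breadth_prop:
  assumes b: "\<And>i. i < t \<Longrightarrow> has_breadth (A i) (le i) (b i)" and pos: "0 < (\<Sum>i<t. b i)"
  shows "breadth_prop P ple (\<Sum>i<t. b i)"
proof (rule product.breadth_propI[OF pos])
  fix m and x :: "nat \<Rightarrow> nat \<Rightarrow> 'a"
  assume m: "(\<Sum>i<t. b i) \<le> m" and x: "\<And>j. j < m \<Longrightarrow> x j \<in> P"
  define good where "good i J \<longleftrightarrow> J \<subseteq> {..<m} \<and> card J = b i \<and>
    (\<forall>w\<in>A i. (\<forall>j\<in>J. le i (x j i) w) \<longrightarrow> (\<forall>j<m. le i (x j i) w))" for i J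
  have "\<exists>J. good i J" if i: "i < t" for i
  proof -
    interpret lattice_carrier "A i" "le i" by (rule factor_carrier[OF i])
    show ?thesis
    proof (cases "b i = 0")
      \<comment> \<open>A factor of breadth 0 is a singleton, where all members and bounds coincide,
        so the empty index set suffices.\<close>
      case True
      then obtain a where a: "A i = {a}" using b[OF i] by (auto simp: has_breadth_def split: if_splits)
      have "x j i = a" if "j < m" for j using component_in[OF x[OF that] i] a by simp
      then have "good i {}" using True a refl[of a] by (auto simp: good_def)
      then show ?thesis ..
    next
      case False
      then have bi: "0 < b i" "breadth_prop (A i) (le i) (b i)"
        using b[OF i] by (auto simp: has_breadth_def split: if_splits)
      have "b i \<le> (\<Sum>i<t. b i)" using i by (intro member_le_sum) auto
      then have "b i \<le> m" using m by simp
      then obtain J where J: "J \<subseteq> {..<m}" "card J = b i"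
        "\<And>w j. w \<in> A i \<Longrightarrow> (\<And>j. j \<in> J \<Longrightarrow> le i (x j i) w) \<Longrightarrow> j < m \<Longrightarrow> le i (x j i) w"
        using breadth_propE[OF bi(2,1), of m "\<lambda>j. x j i"] x i by (metis component_in)
      then have "good i J" by (auto simp: good_def)
      then show ?thesis ..
    qed
  qed
  then obtain J where J: "\<And>i. i < t \<Longrightarrow> good i (J i)" by metis
  show "\<exists>I\<subseteq>{..<m}. card I \<le> (\<Sum>i<t. b i) \<and>
      (\<forall>w\<in>P. (\<forall>i\<in>I. ple (x i) w) \<longrightarrow> (\<forall>i<m. ple (x i) w))"
  proof (intro exI[of _ "\<Union>i<t. J i"] conjI ballI impI allI)
    show "(\<Union>i<t. J i) \<subseteq> {..<m}" using J by (auto simp: good_def)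
    have "card (\<Union>i<t. J i) \<le> (\<Sum>i<t. card (J i))" by (rule card_UN_le) simp
    also have "\<dots> = (\<Sum>i<t. b i)" using J by (intro sum.cong) (auto simp: good_def)
    finally show "card (\<Union>i<t. J i) \<le> (\<Sum>i<t. b i)" .
    fix w j assume w: "w \<in> P" "\<forall>j\<in>\<Union>i<t. J i. ple (x j) w" "j < m"
    show "ple (x j) w"
      unfolding prod_le_def
    proof (intro allI impI)
      fix i assume i: "i < t"
      then have "\<forall>j\<in>J i. le i (x j i) (w i)" using w(2) by (auto simp: prod_le_def)
      then show "le i (x j i) (w i)" using J[OF i] w i by (simp add: good_def)
    qed
  qed
qed

text \<open>Irredundant families of the factors, padded by bottom elements, form an irredundant family
  of the product.\<close>

lemma product_not_breadth_prop:
  assumes b: "\<And>i. i < t \<Longrightarrow> has_breadth (A i) (le i) (b i)" and n: "0 < n" "n < (\<Sum>i<t. b i)"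
  shows "\<not> breadth_prop P ple n"
proof -
  have "\<exists>x. (\<forall>j<b i. x j \<in> A i) \<and> (\<forall>j<b i. \<exists>w\<in>A i. (\<forall>l<b i. l \<noteq> j \<longrightarrow> le i (x l) w) \<and> \<not> le i (x j) w)"
    if "i < t" for i
    using lattice_carrier.irredundant_family[OF factor_carrier[OF that] b[OF that]] by metis
  then obtain x where x: "\<And>i j. i < t \<Longrightarrow> j < b i \<Longrightarrow> x i j \<in> A i"
    and irr: "\<And>i j. i < t \<Longrightarrow> j < b i \<Longrightarrow>
      \<exists>w\<in>A i. (\<forall>l<b i. l \<noteq> j \<longrightarrow> le i (x i l) w) \<and> \<not> le i (x i j) w"
    by metis
  have "\<exists>u. u \<in> A i \<and> (\<forall>a\<in>A i. le i u a)" if "i < t" for i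
    using finite_length_lattice.ex_bot[OF factor[OF that]] by metis
  then obtain bot where bot: "\<And>i. i < t \<Longrightarrow> bot i \<in> A i" "\<And>i a. i < t \<Longrightarrow> a \<in> A i \<Longrightarrow> le i (bot i) a"
    by metis
  obtain T where T: "T \<in> P" "\<And>X. X \<in> P \<Longrightarrow> ple X T" using product.ex_top by metis
  define E where "E = Sigma {..<t} (\<lambda>i. {..<b i})"
  have "finite E" "card E = (\<Sum>i<t. b i)" by (auto simp: E_def card_SigmaI)
  then obtain e where e: "bij_betw e {..<\<Sum>i<t. b i} E"
    by (metis bij_betw_iff_card card_lessThan finite_lessThan)
  define X where "X ij = (restrict bot {..<t})(fst ij := x (fst ij) (snd ij))" for ij
  have XP: "X ij \<in> P" if "ij \<in> E" for ij
    unfolding X_def using that bot x by (intro update_in restrict_in) (auto simp: E_def)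
  show ?thesis
  proof (rule product.not_breadth_propI[OF n(2,1), of "X \<circ> e"])
    show "(X \<circ> e) s \<in> P" if "s < (\<Sum>i<t. b i)" for s
      using XP[of "e s"] bij_betwE[OF e] that by simp
    fix s assume s: "s < (\<Sum>i<t. b i)"
    obtain i j where ij: "e s = (i, j)" by (cases "e s")
    have "(i, j) \<in> E" using bij_betwE[OF e] s ij by (metis lessThan_iff)
    then have i: "i < t" and j: "j < b i" by (auto simp: E_def)
    obtain w where w: "w \<in> A i" "\<And>l. l < b i \<Longrightarrow> l \<noteq> j \<Longrightarrow> le i (x i l) w" "\<not> le i (x i j) w"
      using irr[OF i j] by blast
    \<comment> \<open>The bound is the top element, lowered to \<open>w\<close> at \<open>i\<close>.
      Coordinate \<open>i\<close> of a member other than \<open>s\<close> is the bottom or some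
      \<open>x i l\<close> with \<open>l \<noteq> j\<close>, hence below \<open>w\<close>.\<close>
    show "\<exists>W\<in>P. (\<forall>r<\<Sum>i<t. b i. r \<noteq> s \<longrightarrow> ple ((X \<circ> e) r) W) \<and> \<not> ple ((X \<circ> e) s) W"
    proof (intro bexI[of _ "T(i := w)"] conjI allI impI notI)
      show "T(i := w) \<in> P" using T w i by (intro update_in)
    next
      assume "ple ((X \<circ> e) s) (T(i := w))"
      then show False using w i ij by (auto simp: prod_le_def X_def)
    next
      fix r assume r: "r < (\<Sum>i<t. b i)" "r \<noteq> s"
      obtain i' j' where ij': "e r = (i', j')" by (cases "e r")
      have E': "(i', j') \<in> E" using bij_betwE[OF e] r ij' by (metis lessThan_iff)
      have ne: "(i', j') \<noteq> (i, j)"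
        using e r s ij ij' by (metis bij_betw_def inj_onD lessThan_iff)
      have "ple (X (i', j')) T" using T XP[OF E'] by simp
      then have "le k (X (i', j') k) ((T(i := w)) k)" if "k < t" for k
        using that w bot(2)[of i w] ne E' i
        by (cases "k = i"; cases "i' = i") (auto simp: prod_le_def X_def E_def)
      then show "ple ((X \<circ> e) r) (T(i := w))" by (simp add: prod_le_def ij')
    qed
  qed
qed

lemma product_has_breadth:
  assumes b: "\<And>i. i < t \<Longrightarrow> has_breadth (A i) (le i) (b i)"
  shows "has_breadth P ple (\<Sum>i<t. b i)"
proof -
  \<comment> \<open>The convention for singletons agrees with the sum: all \<open>b i\<close> vanish
    iff every factor, and hence the product, is a singleton.\<close>
  have "b i = 0 \<longleftrightarrow> (\<exists>a. A i = {a})" if "i < t" for i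
    using b[OF that] by (auto simp: has_breadth_def split: if_splits)
  then have "(\<Sum>i<t. b i) = 0 \<longleftrightarrow> (\<exists>X. P = {X})" by (simp add: product_singleton_iff Ball_def)
  note sum0 = this
  show ?thesis
  proof (cases "\<exists>X. P = {X}")
    case True
    then show ?thesis using sum0 by (simp add: has_breadth_def)
  next
    case False
    then have "0 < (\<Sum>i<t. b i)" using sum0 by (intro neq0_conv[THEN iffD1]) blast
    then show ?thesis
      unfolding has_breadth_def if_not_P[OF False]
      using product_breadth_prop[OF b] product_not_breadth_prop[OF b] by blast
  qed
qed

end

section \<open>Closed elements of a polymatroid rank function\<close>

text \<open>\<open>r_step\<close> is the unit-increase axiom in a form that fits a finite sublattice
  \<open>D\<close> of an arbitrary lattice; it makes the closed elements graded by
  \<open>r\<close>.\<close>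

locale polymatroid =
  fixes D :: "'a::lattice set" and r :: "'a \<Rightarrow> nat"
  assumes finite_D: "finite D" and nonempty_D: "D \<noteq> {}"
    and sup_D [simp]: "x \<in> D \<Longrightarrow> y \<in> D \<Longrightarrow> sup x y \<in> D"
    and inf_D [simp]: "x \<in> D \<Longrightarrow> y \<in> D \<Longrightarrow> inf x y \<in> D"
    and r_mono: "x \<in> D \<Longrightarrow> y \<in> D \<Longrightarrow> x \<le> y \<Longrightarrow> r x \<le> r y"
    and r_submodular: "x \<in> D \<Longrightarrow> y \<in> D \<Longrightarrow> r (sup x y) + r (inf x y) \<le> r x + r y"
    and r_step: "x \<in> D \<Longrightarrow> y \<in> D \<Longrightarrow> x < y \<Longrightarrow> \<exists>z\<in>D. x < z \<and> z \<le> y \<and> r z \<le> r x + 1"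
begin

text \<open>The analogue of the flats of a matroid.\<close>

definition closed where "closed = {x \<in> D. \<forall>y\<in>D. x < y \<longrightarrow> r x < r y}"

lemma closed_in: "x \<in> closed \<Longrightarrow> x \<in> D"
  and closed_less: "x \<in> closed \<Longrightarrow> y \<in> D \<Longrightarrow> x < y \<Longrightarrow> r x < r y"
  by (auto simp: closed_def)

text \<open>A maximal element \<open>y\<close> of the same rank as \<open>x\<close> works. If a
  closed \<open>w\<close> above \<open>x\<close> were not above \<open>y\<close>, then
  \<open>sup y w\<close> would have larger rank than \<open>w\<close>, while \<open>inf y w\<close>
  lies above \<open>x\<close> and has rank at least \<open>r y\<close>; this contradicts
  submodularity.\<close>

lemma ex_closure:
  assumes x: "x \<in> D"
  obtains y where "y \<in> closed" "x \<le> y" "r y = r x" "\<And>w. w \<in> closed \<Longrightarrow> x \<le> w \<Longrightarrow> y \<le> w"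
proof -
  let ?S = "{y \<in> D. x \<le> y \<and> r y = r x}"
  obtain y where y: "y \<in> ?S" and max: "\<And>z. z \<in> ?S \<Longrightarrow> y \<le> z \<Longrightarrow> z = y"
    using finite_has_maximal[of ?S] x finite_D by auto
  have "y \<in> closed"
    unfolding closed_def
  proof (intro CollectI conjI ballI impI)
    fix z assume z: "z \<in> D" "y < z"
    then have "r y \<le> r z" using y by (intro r_mono) auto
    moreover have "r z \<noteq> r y" using max[of z] y z order_trans[of x y z] by (auto simp: less_le)
    ultimately show "r y < r z" by simp
  qed (use y in simp)
  moreover have "y \<le> w" if w: "w \<in> closed" "x \<le> w" for w
  proof (rule ccontr)
    assume "\<not> y \<le> w"
    then have "w < sup y w" by (metis less_le sup_ge1 sup_ge2)
    then have "r w < r (sup y w)" using w y closed_in[OF w(1)] by (intro closed_less) auto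
    moreover have "r x \<le> r (inf y w)" using x y w closed_in[OF w(1)] by (intro r_mono) auto
    ultimately show False using r_submodular[of y w] y closed_in[OF w(1)] by simp
  qed
  ultimately show thesis using that y by simp
qed

text \<open>An element \<open>w\<close> strictly above the infimum fails to be below one of the two,
  say \<open>u\<close>. Joining \<open>w\<close> to \<open>u\<close> raises the rank, and by
  submodularity the increase from \<open>inf u w\<close> to \<open>w\<close> is at least as
  large.\<close>

lemma inf_closed:
  assumes "x \<in> closed" "y \<in> closed"
  shows "inf x y \<in> closed"
  unfolding closed_def
proof (intro CollectI conjI ballI impI)
  have D: "x \<in> D" "y \<in> D" using assms closed_in by auto
  then show "inf x y \<in> D" by simp
  fix w assume w: "w \<in> D" "inf x y < w"
  have *: "r (inf x y) < r w" if u: "u \<in> closed" "\<not> w \<le> u" "inf x y \<le> u" for u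
  proof -
    have "u < sup u w" using u by (metis less_le sup_ge1 sup_ge2)
    then have "r u < r (sup u w)" using u w closed_in[OF u(1)] by (intro closed_less) auto
    moreover have "r (inf x y) \<le> r (inf u w)"
      using D u w closed_in[OF u(1)] by (intro r_mono) auto
    ultimately show ?thesis using r_submodular[of u w] closed_in[OF u(1)] w by simp
  qed
  have "\<not> (w \<le> x \<and> w \<le> y)" using w(2) by (metis le_inf_iff leD)
  then show "r (inf x y) < r w" using *[of x] *[of y] assms by auto
qed

lemma inf_glb: "x \<in> closed \<Longrightarrow> y \<in> closed \<Longrightarrow> is_glb closed (\<le>) {x, y} (inf x y)"
  by (auto simp: is_glb_def inf_closed)

lemma closed_lub:
  assumes "x \<in> closed" "y \<in> closed"
  obtains z where "is_lub closed (\<le>) {x, y} z" "r z = r (sup x y)"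
proof -
  obtain z where z: "z \<in> closed" "sup x y \<le> z" "r z = r (sup x y)"
    "\<And>w. w \<in> closed \<Longrightarrow> sup x y \<le> w \<Longrightarrow> z \<le> w"
    using ex_closure[of "sup x y"] assms closed_in sup_D by metis
  then have "is_lub closed (\<le>) {x, y} z" by (auto simp: is_lub_def)
  then show thesis using that z(3) by blast
qed

lemma closed_lattice: "lattice_on closed (\<le>)"
proof -
  have "closed \<noteq> {}" using ex_closure nonempty_D by blast
  moreover have "\<exists>z. is_lub closed (\<le>) {x, y} z" if "x \<in> closed" "y \<in> closed" for x y
    using closed_lub[OF that] by blast
  ultimately show ?thesis unfolding lattice_on_def using inf_glb by (fastforce intro: order_trans)
qed

lemma finite_closed: "finite closed"
  using finite_D by (simp add: closed_def)

sublocale closed: finite_length_lattice closed "(\<le>)"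
proof unfold_locales
  show "lattice_on closed (\<le>)" by (rule closed_lattice)
  show "finite_length closed (\<le>)"
  proof (rule finite_lengthI[of _ r "Max (r ` closed)"])
    show "r x \<le> Max (r ` closed)" if "x \<in> closed" for x using that finite_closed by simp
    show "r x < r y" if "x \<in> closed" "y \<in> closed" "x \<le> y" "x \<noteq> y" for x y
      using that closed_in by (intro closed_less) auto
  qed
qed

lemma join_rank: "x \<in> closed \<Longrightarrow> y \<in> closed \<Longrightarrow> r (join closed (\<le>) x y) = r (sup x y)"
  using closed_lub closed.join_eqI by metis

lemma meet_eq_inf: "x \<in> closed \<Longrightarrow> y \<in> closed \<Longrightarrow> meet closed (\<le>) x y = inf x y"
  by (rule closed.meet_eqI[OF inf_glb])

text \<open>The closure of a first step above \<open>x\<close> has rank at most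
  \<open>r x + 1\<close> and stays below \<open>y\<close>, so it is \<open>y\<close>.\<close>

lemma covers_rank:
  assumes c: "covers closed (\<le>) x y"
  shows "r y = r x + 1"
proof -
  have xy: "x \<in> closed" "y \<in> closed" "x < y" "x \<in> D" "y \<in> D"
    using coversD[OF c] closed_in by (auto simp: less_le)
  obtain z where z: "z \<in> D" "x < z" "z \<le> y" "r z \<le> r x + 1" using r_step[OF xy(4,5,3)] by blast
  obtain w where w: "w \<in> closed" "z \<le> w" "r w = r z" "w \<le> y" using ex_closure[OF z(1)] z(3) xy(2) by metis
  have "w = x \<or> w = y" using coversD(5)[OF c, of w] w z by auto
  then have "w = y" using z w by auto
  then show ?thesis using w z closed_less[OF xy(1,5,3)] by simp
qed

text \<open>Submodularity bounds the rank of the join by \<open>r y + 1\<close>, because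
  \<open>x\<close> has rank one more than \<open>inf x y\<close>; no closed element fits strictly
  between.\<close>

lemma closed_upper_semimodular: "upper_semimodular closed (\<le>)"
  unfolding upper_semimodular_def
proof (intro ballI impI)
  fix x y assume xy: "x \<in> closed" "y \<in> closed" and "covers closed (\<le>) (meet closed (\<le>) x y) x"
  then have c: "covers closed (\<le>) (inf x y) x" by (simp add: meet_eq_inf)
  let ?j = "join closed (\<le>) x y"
  have D: "x \<in> D" "y \<in> D" using xy closed_in by auto
  have j: "?j \<in> closed" "x \<le> ?j" "y \<le> ?j"
    using closed.join_in closed.join_upper1 closed.join_upper2 xy by blast+
  have "y \<noteq> ?j" using coversD(4)[OF c] j(2) by (metis inf_absorb1)
  have "r ?j \<le> r y + 1"
    using covers_rank[OF c] r_submodular[OF D] by (simp add: join_rank xy)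
  then have "z = y \<or> z = ?j" if "z \<in> closed" "y \<le> z" "z \<le> ?j" for z
    using closed_less[of y z] closed_less[of z ?j] that j xy closed_in by (fastforce simp: less_le)
  then show "covers closed (\<le>) y ?j"
    unfolding covers_def using j xy \<open>y \<noteq> ?j\<close> by auto
qed

sublocale closed: graded_semimodular_lattice closed "(\<le>)" "\<lambda>x. int (r x)"
  using closed_upper_semimodular covers_rank by unfold_locales auto

lemma cdist_closed:
  assumes "x \<in> closed" "y \<in> closed"
  shows "int (cdist closed (\<le>) x y) = 2 * int (r (sup x y)) - int (r x) - int (r y)"
  using closed.cdist_rk[OF assms] by (simp add: join_rank assms)

end

section \<open>A lattice of breadth three without the median property\<close>

definition box :: "(nat \<times> nat \<times> nat) set" where
  "box = {..8} \<times> {..8} \<times> {..5}"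

text \<open>The vector rank of a polymatroid on three elements whose subsets have rank 8, 8, 5
  (single elements), 12 (the first two), 9 (the other pairs) and 13 (all): the least value of the
  rank of a subset plus the coordinates outside it. Inside \<open>box\<close>, one-element subsets
  never give a smaller value than the empty one, whence five terms. The 9 lets five units of
  \<open>k\<close> add one rank to \<open>(8, 0, 0)\<close> and \<open>(0, 8, 0)\<close>; the 12,
  being below 13, keeps \<open>(8, 8, 0)\<close> closed.\<close>

fun box_rank :: "nat \<times> nat \<times> nat \<Rightarrow> nat" where
  "box_rank (i, j, k) = min (i + j + k) (min (9 + i) (min (9 + j) (min (12 + k) 13)))"

lemma box_rank_cases: "box_rank (i, j, k) \<in> {i + j + k, 9 + i, 9 + j, 12 + k, 13}"
  by (simp add: min_def)

lemma box_rank_le: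
  "box_rank (i, j, k) \<le> i + j + k" "box_rank (i, j, k) \<le> 9 + i" "box_rank (i, j, k) \<le> 9 + j"
  "box_rank (i, j, k) \<le> 12 + k" "box_rank (i, j, k) \<le> 13"
  by simp_all

lemma box_rank_mono: "i \<le> i' \<Longrightarrow> j \<le> j' \<Longrightarrow> k \<le> k' \<Longrightarrow> box_rank (i, j, k) \<le> box_rank (i', j', k')"
  unfolding box_rank.simps by (intro min.mono) auto

lemma triple_le_iff: "(i, j, k) \<le> (i', j', k') \<longleftrightarrow> i \<le> i' \<and> j \<le> j' \<and> k \<le> (k' :: nat)" for i j i' j' :: nat
  by (simp add: less_eq_prod_def)

lemma triple_less_cases:
  fixes i j k i' j' k' :: nat
  assumes "(i, j, k) < (i', j', k')"
  shows "(i + 1, j, k) \<le> (i', j', k') \<or> (i, j + 1, k) \<le> (i', j', k') \<or> (i, j, k + 1) \<le> (i', j', k')"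
  using assms by (auto simp: less_le triple_le_iff)

text \<open>Uncrossing: for each choice of the terms that attain the minimum at \<open>x\<close> and
  \<open>y\<close>, some two terms at the supremum and the infimum have no larger sum. For
  \<open>9 + i\<close> and \<open>9 + j'\<close> these are 13 and \<open>a + b + c\<close>, by
  \<open>c \<le> 5\<close>; for \<open>9 + i\<close> and \<open>12 + k'\<close> the same two, by
  \<open>b \<le> 8\<close>.\<close>

lemma box_rank_submodular:
  assumes "x \<in> box" "y \<in> box"
  shows "box_rank (sup x y) + box_rank (inf x y) \<le> box_rank x + box_rank y"
proof -
  obtain i j k i' j' k' where [simp]: "x = (i, j, k)" "y = (i', j', k')" by (cases x; cases y) auto
  have b: "i \<le> 8" "j \<le> 8" "k \<le> 5" "i' \<le> 8" "j' \<le> 8" "k' \<le> 5" using assms by (auto simp: box_def)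
  define a where "a = min i i'"
  define a' where "a' = max i i'"
  define b where "b = min j j'"
  define b' where "b' = max j j'"
  define c where "c = min k k'"
  define c' where "c' = max k k'"
  have le: "a \<le> i" "a \<le> i'" "b \<le> j" "b \<le> j'" "c \<le> k" "c \<le> k'"
    and sums: "a + a' = i + i'" "b + b' = j + j'" "c + c' = k + k'"
    by (auto simp: a_def a'_def b_def b'_def c_def c'_def)
  define Q where "Q = box_rank (a', b', c') + box_rank (a, b, c)"
  have Q: "Q \<le> i + j + k + i' + j' + k'" "Q \<le> 18 + i + i'" "Q \<le> 18 + j + j'" "Q \<le> 24 + k + k'" "Q \<le> 26"
    using add_mono[OF box_rank_le(1)[of a' b' c'] box_rank_le(1)[of a b c]]
      add_mono[OF box_rank_le(2)[of a' b' c'] box_rank_le(2)[of a b c]]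
      add_mono[OF box_rank_le(3)[of a' b' c'] box_rank_le(3)[of a b c]]
      add_mono[OF box_rank_le(4)[of a' b' c'] box_rank_le(4)[of a b c]]
      add_mono[OF box_rank_le(5)[of a' b' c'] box_rank_le(5)[of a b c]] sums
    unfolding Q_def[symmetric] by simp_all
  have Q': "Q \<le> 13 + a + b + c" "Q \<le> 22 + a" "Q \<le> 22 + b" "Q \<le> 25 + c"
    using add_mono[OF box_rank_le(5)[of a' b' c'] box_rank_le(1)[of a b c]]
      add_mono[OF box_rank_le(5)[of a' b' c'] box_rank_le(2)[of a b c]]
      add_mono[OF box_rank_le(5)[of a' b' c'] box_rank_le(3)[of a b c]]
      add_mono[OF box_rank_le(5)[of a' b' c'] box_rank_le(4)[of a b c]]
    unfolding Q_def[symmetric] by simp_all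
  have Q'': "Q \<le> 9 + i + i' + b + c" "Q \<le> 9 + j + j' + a + c" "Q \<le> 12 + k + k' + a + b"
    using add_mono[OF box_rank_le(2)[of a' b' c'] box_rank_le(1)[of a b c]]
      add_mono[OF box_rank_le(3)[of a' b' c'] box_rank_le(1)[of a b c]]
      add_mono[OF box_rank_le(4)[of a' b' c'] box_rank_le(1)[of a b c]] sums
    unfolding Q_def[symmetric] by simp_all
  have "Q \<le> box_rank (i, j, k) + box_rank (i', j', k')"
    using box_rank_cases[of i j k] box_rank_cases[of i' j' k'] unfolding insert_iff empty_iff
    by (elim disjE FalseE; use Q Q' Q'' le b in linarith)
  then show ?thesis
    by (simp add: Q_def a_def a'_def b_def b'_def c_def c'_def sup_nat_def inf_nat_def del: box_rank.simps)
qed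

interpretation box: polymatroid box box_rank
proof
  show "finite box" "box \<noteq> {}" by (auto simp: box_def)
  show "sup x y \<in> box" "inf x y \<in> box" if "x \<in> box" "y \<in> box" for x y
    using that by (auto simp: box_def sup_nat_def inf_nat_def)
  show "box_rank x \<le> box_rank y" if "x \<in> box" "y \<in> box" "x \<le> y" for x y
    using that by (cases x; cases y) (simp add: triple_le_iff box_rank_mono del: box_rank.simps)
  show "\<exists>z\<in>box. x < z \<and> z \<le> y \<and> box_rank z \<le> box_rank x + 1" if xy: "x \<in> box" "y \<in> box" "x < y" for x y
  proof -
    obtain i j k i' j' k' where [simp]: "x = (i, j, k)" "y = (i', j', k')" by (cases x; cases y) auto
    have "\<exists>z. z \<in> {(i + 1, j, k), (i, j + 1, k), (i, j, k + 1)} \<and> z \<le> y"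
      using triple_less_cases[of i j k i' j' k'] xy(3) by auto
    then obtain z where z: "z \<in> {(i + 1, j, k), (i, j + 1, k), (i, j, k + 1)}" "z \<le> y" by blast
    then have "z \<in> box" using xy(2) by (auto simp: box_def triple_le_iff)
    moreover have "x < z" using z(1) by (auto simp: less_le triple_le_iff)
    \<comment> \<open>A unit step raises each of the first four terms of the minimum by at most one,
      and the last is constant.\<close>
    moreover have "box_rank z \<le> box_rank x + 1"
    proof -
      have "box_rank z \<le> i + j + k + 1" "box_rank z \<le> 9 + i + 1" "box_rank z \<le> 9 + j + 1"
        "box_rank z \<le> 12 + k + 1" "box_rank z \<le> 13"
        using z(1) box_rank_le[of "i + 1" j k] box_rank_le[of i "j + 1" k] box_rank_le[of i j "k + 1"]
        by (auto simp del: box_rank.simps)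
      then show ?thesis using box_rank_cases[of i j k] by (auto simp del: box_rank.simps)
    qed
    ultimately show ?thesis using z(2) by blast
  qed
qed (rule box_rank_submodular)

text \<open>By monotonicity only the unit steps have to be tested: every larger point of the box
  dominates one of them.\<close>

lemma box_closedI:
  assumes x: "(i, j, k) \<in> box"
    and up: "(i + 1, j, k) \<in> box \<Longrightarrow> box_rank (i, j, k) < box_rank (i + 1, j, k)"
      "(i, j + 1, k) \<in> box \<Longrightarrow> box_rank (i, j, k) < box_rank (i, j + 1, k)"
      "(i, j, k + 1) \<in> box \<Longrightarrow> box_rank (i, j, k) < box_rank (i, j, k + 1)"
  shows "(i, j, k) \<in> box.closed"
  unfolding box.closed_def
proof (intro CollectI conjI ballI impI x)
  fix y assume y: "y \<in> box" "(i, j, k) < y"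
  obtain i' j' k' where y': "y = (i', j', k')" by (cases y) auto
  have "\<exists>z. z \<in> {(i + 1, j, k), (i, j + 1, k), (i, j, k + 1)} \<and> z \<le> y"
    using triple_less_cases[of i j k i' j' k'] y(2) y' by auto
  then obtain z where z: "z \<in> {(i + 1, j, k), (i, j + 1, k), (i, j, k + 1)}" "z \<le> y" by blast
  then have zb: "z \<in> box" using x y y' by (auto simp: box_def triple_le_iff)
  then have "box_rank (i, j, k) < box_rank z" using z(1) up by blast
  then show "box_rank (i, j, k) < box_rank y" using box.r_mono[OF zb y(1) z(2)] by simp
qed

lemma box_not_c1_median_property: "\<not> c1_median_property box.closed (\<le>)"
proof
  assume c1: "c1_median_property box.closed (\<le>)"
  let ?xi = "[(0, 0, 0), (8, 0, 0), (0, 8, 0)] :: (nat \<times> nat \<times> nat) list"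
  let ?R = "\<lambda>z. remoteness box.closed (\<le>) z ?xi"
  have cl: "(0, 0, 0) \<in> box.closed" "(8, 0, 0) \<in> box.closed" "(0, 8, 0) \<in> box.closed"
    "(8, 8, 0) \<in> box.closed" "(0, 0, 5) \<in> box.closed"
    by (rule box_closedI; simp add: box_def)+
  have R: "int (?R z) = (2 * int (box_rank (sup z (0, 0, 0))) - int (box_rank z))
      + (2 * int (box_rank (sup z (8, 0, 0))) - int (box_rank z) - 8)
      + (2 * int (box_rank (sup z (0, 8, 0))) - int (box_rank z) - 8)" if "z \<in> box.closed" for z
    using that cl by (simp add: remoteness_def numeral_3_eq_3 box.cdist_closed)
  \<comment> \<open>Which point is the median need not be known: the assumed property forces its
    third coordinate to be 0, and that already makes it too remote.\<close>
  obtain y where y: "y \<in> box.closed" "\<And>z. z \<in> box.closed \<Longrightarrow> ?R y \<le> ?R z"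
    using ex_has_least_nat[of "\<lambda>z. z \<in> box.closed" _ ?R] cl(1) by blast
  have "is_median box.closed (\<le>) ?xi y" unfolding is_median_def using y by blast
  moreover have "?xi \<noteq> [] \<and> set ?xi \<subseteq> box.closed" using cl by simp
  ultimately have "y \<le> c1 box.closed (\<le>) ?xi"
    using c1[unfolded c1_median_property_def, rule_format, of ?xi y] by blast
  moreover have "c1 box.closed (\<le>) ?xi \<le> (8, 8, 0)"
    unfolding c1_def using cl by (intro box.closed.Join_least) (auto simp: triple_le_iff)
  ultimately have "y \<le> (8, 8, 0)" by (rule order_trans)
  then obtain i j where ij: "y = (i, j, 0)" "i \<le> 8" "j \<le> 8" by (cases y) (auto simp: triple_le_iff)
  have "?R y \<le> ?R (0, 0, 5)" using y cl by blast
  \<comment> \<open>All three distances are 5: the point has rank 5, its suprema with the two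
    profile points of rank 8 have rank 9, and \<open>2 * 9 - 5 - 8 = 5\<close>.\<close>
  then have "int (?R y) \<le> 15" using R[OF cl(5)] by (simp add: sup_nat_def)
  \<comment> \<open>With third coordinate 0 the rank is \<open>min (i + j) 12\<close>, and the
    remoteness \<open>2 * min (8 + i) 12 + 2 * min (8 + j) 12 - min (i + j) 12 - 16\<close> is at
    least 16.\<close>
  moreover have "15 < int (?R y)" using R[OF y(1)] ij by (simp add: sup_nat_def max_def min_def)
  ultimately show False by simp
qed

text \<open>The order is componentwise, so members maximal in the first, second and third coordinate
  suffice. The unit vectors are irredundant because their pairwise suprema are closed.\<close>

lemma box_has_breadth: "has_breadth box.closed (\<le>) 3"
proof -
  have cl: "(1, 0, 0) \<in> box.closed" "(0, 1, 0) \<in> box.closed" "(0, 0, 1) \<in> box.closed"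
    "(1, 1, 0) \<in> box.closed" "(1, 0, 1) \<in> box.closed" "(0, 1, 1) \<in> box.closed"
    by (rule box_closedI; simp add: box_def)+
  have nontriv: "\<not> (\<exists>a. box.closed = {a})" using cl(1,2) by auto
  have bp: "breadth_prop box.closed (\<le>) 3"
  proof (rule box.closed.breadth_propI)
    fix m :: nat and x :: "nat \<Rightarrow> nat \<times> nat \<times> nat"
    assume m: "3 \<le> m" and x: "\<And>i. i < m \<Longrightarrow> x i \<in> box.closed"
    have max: "\<exists>s<m. \<forall>i<m. f (x i) \<le> f (x s)" for f :: "nat \<times> nat \<times> nat \<Rightarrow> nat"
    proof -
      have ne: "(\<lambda>i. f (x i)) ` {..<m} \<noteq> {}" using m by (auto simp: lessThan_empty_iff)
      have "Max ((\<lambda>i. f (x i)) ` {..<m}) \<in> (\<lambda>i. f (x i)) ` {..<m}" using ne by (intro Max_in) auto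
      then obtain s where "s < m" "Max ((\<lambda>i. f (x i)) ` {..<m}) = f (x s)" by auto
      moreover have "f (x i) \<le> Max ((\<lambda>i. f (x i)) ` {..<m})" if "i < m" for i using that by simp
      ultimately show ?thesis by (intro exI[of _ s]) auto
    qed
    obtain a b c where abc: "a < m" "b < m" "c < m"
      and *: "\<And>i. i < m \<Longrightarrow> fst (x i) \<le> fst (x a)" "\<And>i. i < m \<Longrightarrow> fst (snd (x i)) \<le> fst (snd (x b))"
        "\<And>i. i < m \<Longrightarrow> snd (snd (x i)) \<le> snd (snd (x c))"
      using max[of fst] max[of "\<lambda>x. fst (snd x)"] max[of "\<lambda>x. snd (snd x)"] by blast
    have "card {a, b, c} \<le> 3" by (simp add: card_insert_if)
    moreover have "x i \<le> w" if "\<forall>i\<in>{a, b, c}. x i \<le> w" "i < m" for w i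
      using that *[OF that(2)] by (auto simp: less_eq_prod_def intro: order_trans)
    moreover have "{a, b, c} \<subseteq> {..<m}" using abc by simp
    ultimately show "\<exists>I\<subseteq>{..<m}. card I \<le> 3 \<and> (\<forall>w\<in>box.closed. (\<forall>i\<in>I. x i \<le> w) \<longrightarrow> (\<forall>i<m. x i \<le> w))"
      by (intro exI[of _ "{a, b, c}"] conjI ballI impI allI)
  qed simp
  have "\<not> breadth_prop box.closed (\<le>) n" if "0 < n" "n < 3" for n
  proof (rule box.closed.not_breadth_propI[of n 3 "\<lambda>i. if i = 0 then (1, 0, 0) else if i = 1 then (0, 1, 0) else (0, 0, 1)"])
    fix j :: nat assume "j < 3"
    then consider "j = 0" | "j = 1" | "j = 2" by linarith
    then show "\<exists>w\<in>box.closed. (\<forall>i<3. i \<noteq> j \<longrightarrow>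
        (if i = 0 then (1, 0, 0) else if i = 1 then (0, 1, 0) else (0, 0, 1)) \<le> w) \<and>
        \<not> (if j = 0 then (1, 0, 0) else if j = 1 then (0, 1, 0) else (0, 0, 1)) \<le> w"
    proof cases
      case 1 then show ?thesis using cl(6) by (intro bexI[of _ "(0, 1, 1)"]) (auto simp: triple_le_iff)
    next
      case 2 then show ?thesis using cl(5) by (intro bexI[of _ "(1, 0, 1)"]) (auto simp: triple_le_iff)
    next
      case 3 then show ?thesis using cl(4) by (intro bexI[of _ "(1, 1, 0)"]) (auto simp: triple_le_iff)
    qed
  qed (use that cl in auto)
  then show ?thesis using bp nontriv by (auto simp: has_breadth_def)
qed

text \<open>Written with triples, because all factors of \<open>lattice_product\<close> share one
  element type.\<close>

definition two_chain :: "(nat \<times> nat \<times> nat) set" where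
  "two_chain = {(0, 0, 0), (1, 0, 0)}"

interpretation two_chain: polymatroid two_chain fst
proof
  show "finite two_chain" "two_chain \<noteq> {}" by (auto simp: two_chain_def)
  show "sup x y \<in> two_chain" "inf x y \<in> two_chain" if "x \<in> two_chain" "y \<in> two_chain" for x y
    using that by (auto simp: two_chain_def sup_nat_def inf_nat_def)
  show "fst x \<le> fst y" if "x \<le> y" for x y :: "nat \<times> nat \<times> nat"
    using that by (simp add: less_eq_prod_def)
  show "fst (sup x y) + fst (inf x y) \<le> fst x + fst y" for x y :: "nat \<times> nat \<times> nat"
    by (simp add: sup_nat_def inf_nat_def)
  show "\<exists>z\<in>two_chain. x < z \<and> z \<le> y \<and> fst z \<le> fst x + 1"
    if "x \<in> two_chain" "y \<in> two_chain" "x < y" for x y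
    by (rule bexI[of _ y]) (use that in \<open>auto simp: two_chain_def\<close>)
qed

lemma two_chain_closed: "two_chain.closed = {(0, 0, 0), (1, 0, 0)}"
proof -
  have "fst x < fst y" if "x \<in> two_chain" "y \<in> two_chain" "x < y" for x y
    using that by (auto simp: two_chain_def less_le triple_le_iff)
  then have "two_chain.closed = two_chain" unfolding two_chain.closed_def by blast
  then show ?thesis by (simp add: two_chain_def)
qed

lemma two_chain_has_breadth: "has_breadth two_chain.closed (\<le>) 1"
proof -
  have "breadth_prop two_chain.closed (\<le>) 1"
  proof (rule two_chain.closed.breadth_propI)
    fix m :: nat and x :: "nat \<Rightarrow> nat \<times> nat \<times> nat"
    assume m: "1 \<le> m" and x: "\<And>i. i < m \<Longrightarrow> x i \<in> two_chain.closed"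
    have "\<exists>s<m. \<forall>i<m. x i \<le> x s"
    proof (cases "\<exists>s<m. x s = (1, 0, 0)")
      case True
      then obtain s where "s < m" "x s = (1, 0, 0)" by blast
      then show ?thesis
        using x unfolding two_chain_closed by (intro exI[of _ s]) (fastforce simp: triple_le_iff)
    next
      case False
      then have "x i = (0, 0, 0)" if "i < m" for i using x[OF that] that unfolding two_chain_closed by auto
      then show ?thesis using m by (intro exI[of _ 0]) auto
    qed
    then obtain s where "s < m" "\<forall>i<m. x i \<le> x s" by blast
    then show "\<exists>I\<subseteq>{..<m}. card I \<le> 1 \<and>
        (\<forall>w\<in>two_chain.closed. (\<forall>i\<in>I. x i \<le> w) \<longrightarrow> (\<forall>i<m. x i \<le> w))"
      by (intro exI[of _ "{s}"]) (auto intro: order_trans)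
  qed simp
  moreover have "\<not> (\<exists>a. two_chain.closed = {a})" unfolding two_chain_closed by auto
  ultimately show ?thesis by (simp add: has_breadth_def)
qed

section \<open>Transport along an injection\<close>

text \<open>Moves the product, a set of functions, to a carrier of natural numbers. The order on
  \<open>B\<close> is pulled back along an injection into the given lattice, so every notion on
  \<open>B\<close> translates into the same notion on the image.\<close>

locale order_transport =
  fixes B :: "'b set" and g :: "'b \<Rightarrow> 'a" and le :: "'a \<Rightarrow> 'a \<Rightarrow> bool"
  assumes inj: "inj_on g B" and image_lattice: "lattice_on (g ` B) le"
begin

abbreviation le' where "le' u v \<equiv> le (g u) (g v)"

sublocale image: lattice_carrier "g ` B" le
  using image_lattice by unfold_locales

lemma transport_lub: "u \<in> B \<Longrightarrow> is_lub (g ` B) le (g ` S) (g u) \<longleftrightarrow> is_lub B le' S u"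
  by (simp add: is_lub_def)

lemma transport_glb: "u \<in> B \<Longrightarrow> is_glb (g ` B) le (g ` S) (g u) \<longleftrightarrow> is_glb B le' S u"
  by (simp add: is_glb_def)

lemma transport_join_lub:
  assumes "u \<in> B" "v \<in> B"
  obtains z where "z \<in> B" "is_lub B le' {u, v} z" "g z = join (g ` B) le (g u) (g v)"
proof -
  have "join (g ` B) le (g u) (g v) \<in> g ` B" using assms by (intro image.join_in) auto
  then obtain z where z: "z \<in> B" "g z = join (g ` B) le (g u) (g v)" by auto
  then have "is_lub B le' {u, v} z"
    using transport_lub[of z "{u, v}"] image.join_is_lub[of "g u" "g v"] assms by simp
  then show thesis using that z by blast
qed

lemma transport_meet_glb:
  assumes "u \<in> B" "v \<in> B"
  obtains z where "z \<in> B" "is_glb B le' {u, v} z" "g z = meet (g ` B) le (g u) (g v)"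
proof -
  have "meet (g ` B) le (g u) (g v) \<in> g ` B" using assms by (intro image.meet_in) auto
  then obtain z where z: "z \<in> B" "g z = meet (g ` B) le (g u) (g v)" by auto
  then have "is_glb B le' {u, v} z"
    using transport_glb[of z "{u, v}"] image.meet_is_glb[of "g u" "g v"] assms by simp
  then show thesis using that z by blast
qed

lemma transport_lattice: "lattice_on B le'"
  unfolding lattice_on_def
proof (intro conjI ballI impI)
  show "B \<noteq> {}" using image.nonempty by simp
  show "x = y" if "x \<in> B" "y \<in> B" "le' x y \<and> le' y x" for x y
    using image.antisym[of "g x" "g y"] inj_onD[OF inj] that by blast
  show "le' x z" if "x \<in> B" "y \<in> B" "z \<in> B" "le' x y \<and> le' y z" for x y z
    using image.trans[of "g x" "g y" "g z"] that by blast
  show "\<exists>z. is_lub B le' {x, y} z" if "x \<in> B" "y \<in> B" for x y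
    using transport_join_lub[OF that] by metis
  show "\<exists>z. is_glb B le' {x, y} z" if "x \<in> B" "y \<in> B" for x y
    using transport_meet_glb[OF that] by metis
qed (simp add: image.refl)

sublocale source: lattice_carrier B le'
  using transport_lattice by unfold_locales

lemma transport_join: "u \<in> B \<Longrightarrow> v \<in> B \<Longrightarrow> g (join B le' u v) = join (g ` B) le (g u) (g v)"
  using transport_join_lub source.join_eqI by metis

lemma transport_meet: "u \<in> B \<Longrightarrow> v \<in> B \<Longrightarrow> g (meet B le' u v) = meet (g ` B) le (g u) (g v)"
  using transport_meet_glb source.meet_eqI by metis

lemma transport_Join:
  assumes "finite S" "S \<noteq> {}" "S \<subseteq> B"
  shows "g (Join B le' S) = Join (g ` B) le (g ` S)"
proof -
  have "Join B le' S \<in> B" "is_lub B le' S (Join B le' S)"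
    using source.Join_is_lub[OF assms] source.Join_in[OF assms] by auto
  then have "is_lub (g ` B) le (g ` S) (g (Join B le' S))" using transport_lub by simp
  then show ?thesis using image.Join_eqI by metis
qed

lemma transport_covers: "u \<in> B \<Longrightarrow> v \<in> B \<Longrightarrow> covers (g ` B) le (g u) (g v) \<longleftrightarrow> covers B le' u v"
  using inj by (simp add: covers_def inj_on_eq_iff)

lemma transport_edges: "u \<in> B \<Longrightarrow> v \<in> B \<Longrightarrow>
    (g u, g v) \<in> cover_edges (g ` B) le \<longleftrightarrow> (u, v) \<in> cover_edges B le'"
  by (simp add: cover_edges_def transport_covers)

lemma transport_relpow:
  assumes "u \<in> B" "v \<in> B"
  shows "(g u, g v) \<in> cover_edges (g ` B) le ^^ n \<longleftrightarrow> (u, v) \<in> cover_edges B le' ^^ n"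
  using assms(2)
proof (induction n arbitrary: v)
  case 0
  then show ?case using inj assms(1) by (simp add: inj_on_eq_iff)
next
  case (Suc n)
  show ?case
  proof
    assume "(g u, g v) \<in> cover_edges (g ` B) le ^^ Suc n"
    then obtain c where c: "(g u, c) \<in> cover_edges (g ` B) le ^^ n" "(c, g v) \<in> cover_edges (g ` B) le" by auto
    obtain w where w: "w \<in> B" "c = g w" using cover_edges_in[OF c(2)] by blast
    have "(u, w) \<in> cover_edges B le' ^^ n" using c(1) Suc.IH[OF w(1)] w(2) by simp
    moreover have "(w, v) \<in> cover_edges B le'" using c(2) transport_edges[OF w(1) Suc.prems] w(2) by simp
    ultimately show "(u, v) \<in> cover_edges B le' ^^ Suc n" by (rule relpow_Suc_I)
  next
    assume "(u, v) \<in> cover_edges B le' ^^ Suc n"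
    then obtain w where w: "(u, w) \<in> cover_edges B le' ^^ n" "(w, v) \<in> cover_edges B le'" by auto
    have wB: "w \<in> B" using cover_edges_in[OF w(2)] by simp
    have "(g u, g w) \<in> cover_edges (g ` B) le ^^ n" using w(1) Suc.IH[OF wB] by simp
    moreover have "(g w, g v) \<in> cover_edges (g ` B) le" using w(2) transport_edges[OF wB Suc.prems] by simp
    ultimately show "(g u, g v) \<in> cover_edges (g ` B) le ^^ Suc n" by (rule relpow_Suc_I)
  qed
qed

lemma transport_cdist: "u \<in> B \<Longrightarrow> v \<in> B \<Longrightarrow> cdist B le' u v = cdist (g ` B) le (g u) (g v)"
  by (simp add: cdist_eq_Least transport_relpow)

lemma transport_remoteness:
  "y \<in> B \<Longrightarrow> set xi \<subseteq> B \<Longrightarrow> remoteness B le' y xi = remoteness (g ` B) le (g y) (map g xi)"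
  unfolding remoteness_def by (simp, intro sum.cong HOL.refl transport_cdist) (auto simp: subset_iff)

lemma transport_upper_semimodular:
  assumes "upper_semimodular (g ` B) le"
  shows "upper_semimodular B le'"
  unfolding upper_semimodular_def
proof (intro ballI impI)
  fix x y assume xy: "x \<in> B" "y \<in> B" and c: "covers B le' (meet B le' x y) x"
  have "covers (g ` B) le (g (meet B le' x y)) (g x)"
    using c xy by (simp add: transport_covers)
  then have "covers (g ` B) le (g y) (g (join B le' x y))"
    using assms xy unfolding upper_semimodular_def by (simp add: transport_join transport_meet)
  then show "covers B le' y (join B le' x y)" using xy by (simp add: transport_covers)
qed

text \<open>The profile is pulled back along the inverse of \<open>g\<close>. The contrapositive
  carries a counterexample from the image to \<open>B\<close>.\<close>

lemma transport_c1_median_property: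
  assumes c: "c1_median_property B le'"
  shows "c1_median_property (g ` B) le"
  unfolding c1_median_property_def
proof (intro allI impI)
  fix xi y assume xi: "xi \<noteq> [] \<and> set xi \<subseteq> g ` B" and med: "is_median (g ` B) le xi y"
  define zs where "zs = map (the_inv_into B g) xi"
  have zs: "map g zs = xi" "set zs \<subseteq> B" "zs \<noteq> []"
    unfolding zs_def using xi f_the_inv_into_f[OF inj] the_inv_into_into[OF inj _ order_refl]
    by (auto simp: map_idI subset_iff)
  obtain u where u: "u \<in> B" "y = g u" using med by (auto simp: is_median_def)
  have "is_median B le' zs u"
    using med u zs unfolding is_median_def by (simp add: transport_remoteness)
  then have "le' u (c1 B le' zs)" using c zs unfolding c1_median_property_def by simp
  moreover have "g (c1 B le' zs) = c1 (g ` B) le xi"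
    unfolding c1_def using transport_Join[of "set zs"] zs by (metis List.finite_set set_empty set_map)
  ultimately show "le y (c1 (g ` B) le xi)" using u by simp
qed

lemma transport_breadth_prop:
  assumes n: "0 < n"
  shows "breadth_prop B le' n \<longleftrightarrow> breadth_prop (g ` B) le n"
proof
  assume b: "breadth_prop (g ` B) le n"
  show "breadth_prop B le' n"
  proof (rule source.breadth_propI[OF n])
    fix m and x :: "nat \<Rightarrow> 'b" assume m: "n \<le> m" and x: "\<And>i. i < m \<Longrightarrow> x i \<in> B"
    have gx: "g (x i) \<in> g ` B" if "i < m" for i using x[OF that] by simp
    obtain I where I: "I \<subseteq> {..<m}" "card I = n"
      "\<And>w i. w \<in> g ` B \<Longrightarrow> (\<And>i. i \<in> I \<Longrightarrow> le (g (x i)) w) \<Longrightarrow> i < m \<Longrightarrow> le (g (x i)) w"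
      using image.breadth_propE[OF b n m, of "\<lambda>i. g (x i)"] gx by metis
    have "le (g (x i)) (g w)" if "w \<in> B" "\<forall>i\<in>I. le (g (x i)) (g w)" "i < m" for w i
      using I(3)[of "g w" i] that by simp
    then show "\<exists>I\<subseteq>{..<m}. card I \<le> n \<and>
        (\<forall>w\<in>B. (\<forall>i\<in>I. le' (x i) w) \<longrightarrow> (\<forall>i<m. le' (x i) w))"
      using I(1,2) by (intro exI[of _ I]) auto
  qed
next
  assume b: "breadth_prop B le' n"
  show "breadth_prop (g ` B) le n"
  proof (rule image.breadth_propI[OF n])
    fix m and y :: "nat \<Rightarrow> 'a" assume m: "n \<le> m" and y: "\<And>i. i < m \<Longrightarrow> y i \<in> g ` B"
    define x where "x i = the_inv_into B g (y i)" for i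
    have x: "x i \<in> B" "g (x i) = y i" if "i < m" for i
      using y[OF that] the_inv_into_into[OF inj _ order_refl] f_the_inv_into_f[OF inj]
      by (auto simp: x_def)
    obtain I where I: "I \<subseteq> {..<m}" "card I = n"
      "\<And>w i. w \<in> B \<Longrightarrow> (\<And>i. i \<in> I \<Longrightarrow> le' (x i) w) \<Longrightarrow> i < m \<Longrightarrow> le' (x i) w"
      using source.breadth_propE[OF b n m, of x] x by metis
    have "le (y i) w" if w: "w \<in> g ` B" "\<forall>i\<in>I. le (y i) w" "i < m" for w i
    proof -
      obtain u where u: "u \<in> B" "w = g u" using w(1) by blast
      have "le' (x j) u" if "j \<in> I" for j using w(2) that I(1) u x(2)[of j] by auto
      then show ?thesis using I(3)[OF u(1) _ w(3)] x(2)[OF w(3)] u by simp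
    qed
    then show "\<exists>I\<subseteq>{..<m}. card I \<le> n \<and>
        (\<forall>w\<in>g ` B. (\<forall>i\<in>I. le (y i) w) \<longrightarrow> (\<forall>i<m. le (y i) w))"
      using I(1,2) by (intro exI[of _ I]) auto
  qed
qed

lemma transport_has_breadth:
  assumes "has_breadth (g ` B) le n"
  shows "has_breadth B le' n"
proof -
  have "(\<exists>a. g ` B = {a}) \<longleftrightarrow> (\<exists>b. B = {b})"
  proof
    assume "\<exists>a. g ` B = {a}"
    then obtain a where a: "g ` B = {a}" ..
    obtain b where b: "b \<in> B" using source.nonempty by blast
    have "u = b" if "u \<in> B" for u
      using inj_onD[OF inj _ that b] imageI[OF that, of g] imageI[OF b, of g] a by simp
    then show "\<exists>b. B = {b}" using b by blast
  qed auto
  then show ?thesis using assms unfolding has_breadth_def by (auto simp: transport_breadth_prop)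
qed

end

section \<open>Counterexamples of every breadth from three on\<close>

lemma ex_semimodular_breadth_not_c1:
  assumes k: "3 \<le> k"
  shows "\<exists>(A :: nat set) le. finite A \<and> lattice_on A le \<and> upper_semimodular A le
           \<and> has_breadth A le k \<and> \<not> c1_median_property A le"
proof -
  \<comment> \<open>One copy of the lattice of breadth 3 and \<open>k - 3\<close> two-element
    chains: \<open>k - 2\<close> factors, of total breadth \<open>3 + (k - 3)\<close>.\<close>
  define F :: "nat \<Rightarrow> (nat \<times> nat \<times> nat) set"
    where "F i = (if i = 0 then box.closed else two_chain.closed)" for i
  define b :: "nat \<Rightarrow> nat" where "b i = (if i = 0 then 3 else 1)" for i
  interpret lattice_product "k - 2" F "\<lambda>_. (\<le>)"
    by unfold_locales (auto simp: F_def box.closed_lattice two_chain.closed_lattice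
        box.closed.finite_length two_chain.closed.finite_length)
  have sm: "upper_semimodular P ple"
    by (rule product_upper_semimodular)
      (simp add: F_def box.closed_upper_semimodular two_chain.closed_upper_semimodular)
  have "has_breadth P ple (\<Sum>i<k - 2. b i)"
    by (rule product_has_breadth) (simp add: F_def b_def box_has_breadth two_chain_has_breadth[unfolded One_nat_def])
  moreover have "(\<Sum>i<k - 2. b i) = k"
    using k by (simp add: b_def sum.remove[of "{..<k - 2}" 0])
  ultimately have br: "has_breadth P ple k" by simp
  have nc: "\<not> c1_median_property P ple"
    using product_c1_median_propertyD[of 0] box_not_c1_median_property k by (auto simp: F_def)
  have "finite (F i)" for i by (simp add: F_def box.finite_closed two_chain.finite_closed)
  then have "finite P" unfolding prod_carrier_def by (intro finite_PiE) auto
  \<comment> \<open>A finite \<open>P\<close> has a copy \<open>B\<close> in the natural numbers;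
    the order is pulled back along \<open>inv_into P h\<close>, which is injective on
    \<open>B\<close> and has image \<open>P\<close>.\<close>
  then obtain h :: "(nat \<Rightarrow> nat \<times> nat \<times> nat) \<Rightarrow> nat" where h: "inj_on h P"
    using finite_imp_inj_to_nat_seg by blast
  define B where "B = h ` P"
  have P: "inv_into P h ` B = P" unfolding B_def using h by simp
  interpret tr: order_transport B "inv_into P h" ple
    by unfold_locales (simp_all add: P product_lattice, simp add: B_def inj_on_inv_into)
  show ?thesis
  proof (intro exI[of _ B] exI[of _ tr.le'] conjI)
    show "finite B" using \<open>finite P\<close> by (simp add: B_def)
    show "lattice_on B tr.le'" by (rule tr.transport_lattice)
    show "upper_semimodular B tr.le'" by (rule tr.transport_upper_semimodular[unfolded P, OF sm])
    show "has_breadth B tr.le' k" by (rule tr.transport_has_breadth[unfolded P, OF br])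
    show "\<not> c1_median_property B tr.le'" using tr.transport_c1_median_property[unfolded P] nc by (rule contrapos_nn[rotated])
  qed
qed

theorem theorem4p1:
  shows "(\<forall>(A :: 'a set) le.
            lattice_on A le \<and> finite_length A le \<and> upper_semimodular A le
            \<and> (\<exists>n\<le>2. has_breadth A le n)
            \<longrightarrow> c1_median_property A le)
       \<and> (\<forall>k::nat. k \<ge> 3 \<longrightarrow>
            (\<exists>(A :: nat set) le. finite A \<and> lattice_on A le \<and> upper_semimodular A le
               \<and> has_breadth A le k \<and> \<not> c1_median_property A le))
       \<and> (\<forall>(t::nat) (A :: nat \<Rightarrow> 'b set) le.
            0 < t \<and> (\<forall>i<t. lattice_on (A i) (le i) \<and> finite_length (A i) (le i)
                           \<and> c1_median_property (A i) (le i))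
            \<longrightarrow> lattice_on (prod_carrier t A) (prod_le t le)
              \<and> finite_length (prod_carrier t A) (prod_le t le)
              \<and> c1_median_property (prod_carrier t A) (prod_le t le)
              \<and> (\<forall>b. (\<forall>i<t. has_breadth (A i) (le i) (b i))
                     \<longrightarrow> has_breadth (prod_carrier t A) (prod_le t le) (\<Sum>i<t. b i))
              \<and> ((\<forall>i<t. upper_semimodular (A i) (le i))
                     \<longrightarrow> upper_semimodular (prod_carrier t A) (prod_le t le)))"
proof (rule conjI[OF _ conjI])
  show "\<forall>(A :: 'a set) le. lattice_on A le \<and> finite_length A le \<and> upper_semimodular A le
      \<and> (\<exists>n\<le>2. has_breadth A le n) \<longrightarrow> c1_median_property A le"
    using c1_median_property_breadth_le_2 by metis
  show "\<forall>k::nat. k \<ge> 3 \<longrightarrow> (\<exists>(A :: nat set) le. finite A \<and> lattice_on A le \<and> upper_semimodular A le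
      \<and> has_breadth A le k \<and> \<not> c1_median_property A le)"
    using ex_semimodular_breadth_not_c1 by simp
  show "\<forall>(t::nat) (A :: nat \<Rightarrow> 'b set) le.
      0 < t \<and> (\<forall>i<t. lattice_on (A i) (le i) \<and> finite_length (A i) (le i)
                     \<and> c1_median_property (A i) (le i))
      \<longrightarrow> lattice_on (prod_carrier t A) (prod_le t le)
        \<and> finite_length (prod_carrier t A) (prod_le t le)
        \<and> c1_median_property (prod_carrier t A) (prod_le t le)
        \<and> (\<forall>b. (\<forall>i<t. has_breadth (A i) (le i) (b i))
               \<longrightarrow> has_breadth (prod_carrier t A) (prod_le t le) (\<Sum>i<t. b i))
        \<and> ((\<forall>i<t. upper_semimodular (A i) (le i))
               \<longrightarrow> upper_semimodular (prod_carrier t A) (prod_le t le))"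
  proof (intro allI, rule impI)
    fix t :: nat and A :: "nat \<Rightarrow> 'b set" and le
    assume a: "0 < t \<and> (\<forall>i<t. lattice_on (A i) (le i) \<and> finite_length (A i) (le i)
                     \<and> c1_median_property (A i) (le i))"
    interpret lattice_product t A le using a by unfold_locales auto
    show "lattice_on (prod_carrier t A) (prod_le t le)
        \<and> finite_length (prod_carrier t A) (prod_le t le)
        \<and> c1_median_property (prod_carrier t A) (prod_le t le)
        \<and> (\<forall>b. (\<forall>i<t. has_breadth (A i) (le i) (b i))
               \<longrightarrow> has_breadth (prod_carrier t A) (prod_le t le) (\<Sum>i<t. b i))
        \<and> ((\<forall>i<t. upper_semimodular (A i) (le i))
               \<longrightarrow> upper_semimodular (prod_carrier t A) (prod_le t le))"
      using a product_lattice product_finite_length product_c1_median_property product_has_breadth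
        product_upper_semimodular by simp
  qed
qed

end
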